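(* For every $n\ge10$ and $c\in(0,1/2)$ such that $cn$ is an integer, and every $\lambda_1,\lambda_2,\lambda_3,\lambda_4\ge0$ with $\sum_i\lambda_i=1$, every non-opposite cut on $I=\lambda_1I_1+\lambda_2I_2+\lambda_3I_3+\lambda_4I_4$ has cost at least the minimum of the following two terms: (i) $\lambda_2+(1.2-\frac1n)\lambda_1+\min_{\alpha\in[0,\frac12]}\{0.4\alpha\lambda_1+3(\frac12-\alpha)\lambda_4\}$; (ii) $2\lambda_2+(1.2-\frac{5}{2n})\lambda_1+3\min\left\{\frac{2\lambda_3}{9c},\min_{\alpha\in[0,\frac{c^2}{2}]}\{0.4\alpha\lambda_1+3(\frac{c^2}{2}-\alpha)\lambda_4\}\right\}$.
   Context: Let $\Delta_{k,n}=\{x\in[0,1]^k:\sum_ix_i=1,\ nx\in\mathbb{Z}^k\}$, $e^i$ the $i$-th unit vector, $\mathrm{Support}(x)=\{i:x_i\neq0\}$. Let $G$ be the graph with node set $\Delta_{4,n}$ and edge set $E_{4,n}=\{xy:\|x-y\|_1=2/n\}$. A cut is $P:\Delta_{4,n}\to[5]$ with $P(e^i)=i$ ($i\in[4]$); it is non-opposite if $P(x)\in\mathrm{Support}(x)\cup\{5\}$ for all $x$. For an edge weighting (instance), the cost of $P$ is the total weight of edges $xy$ with $P(x)\neq P(y)$. For distinct $i,j$, $V_{ij}=\{x:\mathrm{Support}(x)\subseteq\{i,j\}\}$ and $L_{ij}$ is the set of edges with both endpoints in $V_{ij}$. Identify $\Delta_{3,n}$ with the face $\{x\in\Delta_{4,n}:x_4=0\}$.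 Instance $J$ on $\Delta_{3,n}$ (edges $E_{3,n}$ = edges of $G$ inside this face); here $n$ is divisible by 3. Let $\rho=3/(5n)$ and $T_i=\{x\in\Delta_{3,n}:x_i>2/3\}$. For distinct $i,j\in[3]$ and $t\in\{1,\dots,n/3\}$, the edge of $L_{ij}$ whose endpoints have $i$-th coordinates $1-(t-1)/n$ and $1-t/n$ has cost $(n/3-t+1)\rho$ (and symmetrically with $j$ in place of $i$); every edge $xy\notin L_{12}\cup L_{13}\cup L_{23}$ with $x,y\in T_i$ for some $i$ and $x_i=y_i$ has cost $0$; every other edge of $E_{3,n}$ has cost $\rho$. For $k\in[3]$ and $\{i,j,k\}=[3]$: $U_k=\{x\in\Delta_{4,n}:x_4=0,x_k=1-c\}$, $R_k=U_k\cup\{x\in V_{ik}\cup V_{jk}:x_k\ge1-c\}$, and red edges $\Gamma_k=\{xy\in E_{4,n}:x,y\in R_k\}$. Instances (edge weights on $E_{4,n}$): $I_1$ gives face edges their $J$-cost and all other edges $0$; $I_2$ gives weight $1/3$ to edges in $L_{12}\cup L_{13}\cup L_{23}$ and $0$ otherwise; $I_3$ gives weight $1/(9c)$ to edges in $\Gamma_1\cup\Gamma_2\cup\Gamma_3$ and $0$ otherwise; $I_4$ gives weight $1/n^2$ to every edge. $I=\sum_i\lambda_iI_i$ is the weighting $\sum_i\lambda_i w_{I_i}$. *)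

theory Defs
  imports Complex_Main "HOL-Library.FuncSet"
begin

text \<open>Points of the discrete simplices are functions on \<^typ>\<open>nat\<close> with coordinates
  \<open>1, \<dots>, k\<close> that vanish elsewhere. Thus \<open>Delta 3 n\<close> is literally the face \<open>x 4 = 0\<close>
  of \<open>Delta 4 n\<close>.\<close>

type_synonym point = "nat \<Rightarrow> real"

definition Delta :: "nat \<Rightarrow> nat \<Rightarrow> point set" where
  "Delta k n = {x. (\<forall>i\<in>{1..k}. 0 \<le> x i \<and> x i \<le> 1) \<and> (\<forall>i. i \<notin> {1..k} \<longrightarrow> x i = 0)
     \<and> (\<Sum>i=1..k. x i) = 1 \<and> (\<forall>i\<in>{1..k}. real n * x i \<in> \<int>)}"

definition unit_vec :: "nat \<Rightarrow> point" where
  "unit_vec i = (\<lambda>j. if j = i then 1 else 0)"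

definition Support :: "point \<Rightarrow> nat set" where
  "Support x = {i. x i \<noteq> 0}"

text \<open>Edges are unordered pairs, i.e. sets \<open>{x, y}\<close>; the distance \<open>2 / n\<close> forces \<open>x \<noteq> y\<close>.\<close>

definition E :: "nat \<Rightarrow> nat \<Rightarrow> point set set" where
  "E k n = {{x, y} | x y. x \<in> Delta k n \<and> y \<in> Delta k n
     \<and> (\<Sum>i=1..k. \<bar>x i - y i\<bar>) = 2 / real n}"

definition is_cut :: "nat \<Rightarrow> (point \<Rightarrow> nat) \<Rightarrow> bool" where
  "is_cut n P \<longleftrightarrow> P \<in> Delta 4 n \<rightarrow> {1..5} \<and> (\<forall>i\<in>{1..4}. P (unit_vec i) = i)"

definition non_opposite :: "nat \<Rightarrow> (point \<Rightarrow> nat) \<Rightarrow> bool" where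
  "non_opposite n P \<longleftrightarrow> (\<forall>x\<in>Delta 4 n. P x \<in> Support x \<union> {5})"

text \<open>An instance is an edge weighting; only its values on \<open>E 4 n\<close> matter.\<close>

type_synonym weighting = "point set \<Rightarrow> real"

definition cost :: "nat \<Rightarrow> weighting \<Rightarrow> (point \<Rightarrow> nat) \<Rightarrow> real" where
  "cost n w P = (\<Sum>e \<in> {e \<in> E 4 n. \<exists>x y. e = {x, y} \<and> P x \<noteq> P y}. w e)"

definition V :: "nat \<Rightarrow> nat \<Rightarrow> nat \<Rightarrow> point set" where
  "V n i j = {x \<in> Delta 4 n. Support x \<subseteq> {i, j}}"

definition L :: "nat \<Rightarrow> nat \<Rightarrow> nat \<Rightarrow> point set set" where
  "L n i j = {e \<in> E 4 n. e \<subseteq> V n i j}"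

definition T :: "nat \<Rightarrow> nat \<Rightarrow> point set" where
  "T n i = {x \<in> Delta 3 n. x i > 2 / 3}"

definition rho :: "nat \<Rightarrow> real" where
  "rho n = 3 / (5 * real n)"

text \<open>\<open>side_rank n e t\<close>: for some distinct \<open>i, j \<in> {1, 2, 3}\<close>, \<open>e\<close> is the \<open>t\<close>-th edge of
  \<open>L n i j\<close> counted from the corner \<open>unit_vec i\<close>, where \<open>1 \<le> t \<le> n / 3\<close>.\<close>

definition side_rank :: "nat \<Rightarrow> point set \<Rightarrow> nat \<Rightarrow> bool" where
  "side_rank n e t \<longleftrightarrow> t \<in> {1..n div 3} \<and>
     (\<exists>i\<in>{1..3}. \<exists>j\<in>{1..3}. i \<noteq> j \<and> e \<in> L n i j \<and>
       (\<exists>x y. e = {x, y} \<and> x i = 1 - (real t - 1) / real n \<and> y i = 1 - real t / real n))"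

definition J :: "nat \<Rightarrow> weighting" where
  "J n e =
    (if \<exists>t. side_rank n e t then (real n / 3 - real (THE t. side_rank n e t) + 1) * rho n
     else if e \<notin> L n 1 2 \<union> L n 1 3 \<union> L n 2 3 \<and>
       (\<exists>i\<in>{1..3}. \<exists>x y. e = {x, y} \<and> x \<in> T n i \<and> y \<in> T n i \<and> x i = y i) then 0
     else rho n)"

definition U :: "nat \<Rightarrow> real \<Rightarrow> nat \<Rightarrow> point set" where
  "U n c k = {x \<in> Delta 4 n. x 4 = 0 \<and> x k = 1 - c}"

definition R :: "nat \<Rightarrow> real \<Rightarrow> nat \<Rightarrow> point set" where
  "R n c k = U n c k \<union> {x \<in> (\<Union>i\<in>{1..3} - {k}. V n i k). x k \<ge> 1 - c}"

definition red_edges :: "nat \<Rightarrow> real \<Rightarrow> nat \<Rightarrow> point set set" where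
  "red_edges n c k = {e \<in> E 4 n. e \<subseteq> R n c k}"

definition I1 :: "nat \<Rightarrow> weighting" where
  "I1 n e = (if e \<in> E 3 n then J n e else 0)"

definition I2 :: "nat \<Rightarrow> weighting" where
  "I2 n e = (if e \<in> L n 1 2 \<union> L n 1 3 \<union> L n 2 3 then 1 / 3 else 0)"

definition I3 :: "nat \<Rightarrow> real \<Rightarrow> weighting" where
  "I3 n c e = (if e \<in> red_edges n c 1 \<union> red_edges n c 2 \<union> red_edges n c 3
     then 1 / (9 * c) else 0)"

definition I4 :: "nat \<Rightarrow> weighting" where
  "I4 n e = 1 / (real n)\<^sup>2"

definition combined_instance ::
    "nat \<Rightarrow> real \<Rightarrow> real \<Rightarrow> real \<Rightarrow> real \<Rightarrow> real \<Rightarrow> weighting" where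
  "combined_instance n c l1 l2 l3 l4 =
     (\<lambda>e. l1 * I1 n e + l2 * I2 n e + l3 * I3 n c e + l4 * I4 n e)"

text \<open>The sum in \<^const>\<open>cost\<close> is over a finite set, and the rank chosen in
  \<^const>\<open>J\<close> is unique.\<close>

lemma finite_Delta:
  assumes "n > 0"
  shows "finite (Delta k n)"
proof -
  let ?F = "PiE {1..k} (\<lambda>_. (\<lambda>m. real m / real n) ` {..n})"
  have "x \<in> (\<lambda>f i. if i \<in> {1..k} then f i else 0) ` ?F" if x: "x \<in> Delta k n" for x
  proof
    show "x = (\<lambda>i. if i \<in> {1..k} then restrict x {1..k} i else 0)"
      using x by (auto simp: Delta_def fun_eq_iff)
    show "restrict x {1..k} \<in> ?F"
    proof (rule restrict_PiE_iff[THEN iffD2], rule ballI)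
      fix i assume i: "i \<in> {1..k}"
      then have "real n * x i \<in> \<int>" using x by (simp add: Delta_def)
      then obtain z where z: "real n * x i = of_int z" by (rule Ints_cases)
      have "0 \<le> x i" "x i \<le> 1" using x i by (auto simp: Delta_def)
      then have b: "0 \<le> real n * x i" "real n * x i \<le> real n"
        by (simp_all add: mult_left_le)
      then have "0 \<le> z" "z \<le> int n" unfolding z by linarith+
      moreover have "x i = real (nat z) / real n"
        using z \<open>0 \<le> z\<close> assms by (simp add: field_simps)
      ultimately show "x i \<in> (\<lambda>m. real m / real n) ` {..n}"
        by (intro image_eqI[where x = "nat z"]) auto
    qed
  qed
  then have "Delta k n \<subseteq> (\<lambda>f i. if i \<in> {1..k} then f i else 0) ` ?F" by blast
  moreover have "finite ?F" by (intro finite_PiE) auto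
  ultimately show ?thesis by (meson finite_imageI finite_subset)
qed

lemma finite_E: "n > 0 \<Longrightarrow> finite (E k n)"
  by (rule finite_subset[of _ "Pow (Delta k n)"]) (auto simp: E_def finite_Delta)

lemma side_rank_unique:
  assumes "side_rank n e t" "side_rank n e t'"
  shows "t = t'"
proof -
  from assms(1) obtain i j x y where 1: "t \<in> {1..n div 3}" "i \<in> {1..3}" "e \<in> L n i j"
    "e = {x, y}" "x i = 1 - (real t - 1) / real n" "y i = 1 - real t / real n"
    unfolding side_rank_def by blast
  from assms(2) obtain i' j' x' y' where 2: "t' \<in> {1..n div 3}" "i' \<in> {1..3}"
    "e = {x', y'}" "x' i' = 1 - (real t' - 1) / real n" "y' i' = 1 - real t' / real n"
    unfolding side_rank_def by blast
  have n: "real n > 0" using 1(1) by (cases n) auto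
  have "real t \<le> real n / 3" "real t' \<le> real n / 3" using 1(1) 2(1) by auto
  then have b: "real t / real n \<le> 1 / 3" "real t' / real n \<le> 1 / 3"
    using n by (simp_all add: field_simps)
  have p: "1 / real n > 0" using n by simp
  have x: "x \<in> Delta 4 n" using 1(3,4) by (auto simp: L_def V_def)
  have ii: "i = i'"
  proof (rule ccontr)
    assume ne: "i \<noteq> i'"
    have "x i + x i' = (\<Sum>m\<in>{i, i'}. x m)" using ne by simp
    also have "\<dots> \<le> (\<Sum>m=1..4. x m)"
      using 1(2) 2(2) x by (intro sum_mono2) (auto simp: Delta_def)
    also have "\<dots> = 1" using x by (simp add: Delta_def)
    finally have s: "x i + x i' \<le> 1" .
    have "x i \<ge> 2 / 3" using b(1) p unfolding 1(5) diff_divide_distrib by linarith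
    moreover have "x i' \<ge> 2 / 3"
    proof -
      have "x' i' \<ge> 2 / 3" using b(2) p unfolding 2(4) diff_divide_distrib by linarith
      moreover have "y' i' \<ge> 2 / 3" using b(2) unfolding 2(5) by linarith
      ultimately show ?thesis using 1(4) 2(3) by (auto simp: doubleton_eq_iff)
    qed
    ultimately show False using s by simp
  qed
  from 1(4) 2(3) consider "x = x'" "y = y'" | "x = y'" "y = x'"
    by (auto simp: doubleton_eq_iff)
  then show ?thesis
  proof cases
    case 1
    then show ?thesis using ii \<open>y i = _\<close> \<open>y' i' = _\<close> n by simp
  next
    case 2
    have "1 - (real t - 1) / real n = 1 - real t' / real n"
      using 2(1) ii \<open>x i = _\<close> \<open>y' i' = _\<close> by metis
    moreover have "1 - real t / real n = 1 - (real t' - 1) / real n"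
      using 2(2) ii \<open>y i = _\<close> \<open>x' i' = _\<close> by metis
    ultimately have "real t - 1 = real t'" "real t = real t' - 1"
      using n by (auto simp: divide_cancel_right)
    then show ?thesis by linarith
  qed
qed

lemma J_side_rank: "side_rank n e t \<Longrightarrow> J n e = (real n / 3 - real t + 1) * rho n"
  using side_rank_unique[of n e] unfolding J_def by (auto simp: the_equality)

end

theory Submission
  imports Defs
begin

text \<open>Scale the simplex by \<open>n\<close> and group the edges into cells: the cell at a lattice
point \<open>v\<close> of coordinate sum \<open>n - 1\<close> has the corners \<open>v + e_i\<close>. In a labelling that respects
supports, a cell all of whose corners are labelled \<open>i\<close> can be charged to \<open>v - e_i\<close>, and this
is injective even if cells labelled \<open>5\<close> are charged to \<open>v - e_k\<close> for one fixed \<open>k\<close>. In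
dimension 4 this leaves one non-monochromatic tetrahedron, hence three cut edges, for each
cell of the face that is not entirely labelled \<open>5\<close>; in dimension 3 it leaves \<open>n\<close>
non-monochromatic triangles, hence \<open>2 n\<close> cut edges, when one side carries no \<open>5\<close>.

The weights of \<open>J\<close> are handled by repainting each \<open>T_i\<close> with \<open>i\<close>: lines of \<open>T_i\<close> show that
the \<open>J\<close>-cost is at least \<open>rho\<close> times the number of edges cut afterwards. For a repainted
labelling this number is at least \<open>2 n\<close>: either some connected set of \<open>5\<close>s meets all three
sides and is then crossed twice by every line near a corner, or each component of \<open>5\<close>s avoids
a side and can be relabelled away. This gives \<open>1.2\<close>. If a side carries no \<open>5\<close>, the points
of sum \<open>n - 2\<close> not charged by any cell, together with the lines of the \<open>T_i\<close> where the
repainting is not tight, pay for the cells labelled \<open>5\<close>. Otherwise every side is cut twice,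
and each corner triangle \<open>x_k \<ge> 1 - c\<close> either has two red cut edges, or has a boundary labelled
\<open>k\<close> throughout, and repainting it with \<open>k\<close> pays for the cells labelled \<open>5\<close> inside it.\<close>

section \<open>Cells of the lattice simplex\<close>

definition lat :: "nat set \<Rightarrow> nat \<Rightarrow> (nat \<Rightarrow> nat) set" where
  "lat I m = {x. (\<forall>i. i \<notin> I \<longrightarrow> x i = 0) \<and> sum x I = m}"

definition bump :: "nat \<Rightarrow> (nat \<Rightarrow> nat) \<Rightarrow> nat \<Rightarrow> nat" where
  "bump i v = v(i := Suc (v i))"

definition mono_cell :: "nat set \<Rightarrow> ((nat \<Rightarrow> nat) \<Rightarrow> nat) \<Rightarrow> (nat \<Rightarrow> nat) \<Rightarrow> nat \<Rightarrow> bool" where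
  "mono_cell I f v a \<longleftrightarrow> (\<forall>j\<in>I. f (bump j v) = a)"

lemma bump_apply: "bump i v j = (if j = i then Suc (v i) else v j)"
  by (simp add: bump_def)

lemma bump_commute: "bump i (bump j v) = bump j (bump i v)"
  by (auto simp: bump_def fun_eq_iff)

lemma bump_inject: "bump i v = bump i w \<longleftrightarrow> v = w"
  unfolding bump_def fun_eq_iff by (metis fun_upd_apply nat.inject)

lemma finite_lat [simp]:
  assumes "finite I" shows "finite (lat I m)"
proof -
  have "finite {x. \<forall>i. (i \<in> I \<longrightarrow> x i \<in> {..m}) \<and> (i \<notin> I \<longrightarrow> x i = (0::nat))}"
    using assms by (intro finite_set_of_finite_funs) auto
  then show ?thesis
    by (rule rev_finite_subset) (use assms in \<open>auto simp: lat_def intro: member_le_sum\<close>)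
qed

lemma bump_lat:
  assumes "finite I" "i \<in> I"
  shows "bump i v \<in> lat I (Suc m) \<longleftrightarrow> v \<in> lat I m"
proof -
  have "sum (bump i v) (I - {i}) = sum v (I - {i})"
    by (rule sum.cong) (auto simp: bump_def)
  then have "sum (bump i v) I = Suc (sum v I)"
    using assms sum.remove[of I i v] sum.remove[of I i "bump i v"] by (simp add: bump_apply)
  moreover have "(\<forall>j. j \<notin> I \<longrightarrow> bump i v j = 0) \<longleftrightarrow> (\<forall>j. j \<notin> I \<longrightarrow> v j = 0)"
    using assms by (auto simp: bump_def)
  ultimately show ?thesis by (simp add: lat_def)
qed

lemma unbump:
  assumes "0 < v i" obtains u where "v = bump i u"
proof
  show "v = bump i (v(i := v i - 1))" using assms by (simp add: bump_def fun_eq_iff)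
qed

text \<open>The points of sum \<open>m\<close> to which no monochromatic cell is charged; \<open>z\<close> is the label that need
  not respect supports.\<close>

definition unhit :: "nat set \<Rightarrow> nat \<Rightarrow> nat \<Rightarrow> ((nat \<Rightarrow> nat) \<Rightarrow> nat) \<Rightarrow> nat \<Rightarrow> (nat \<Rightarrow> nat) set" where
  "unhit I k z f m = {u \<in> lat I m. (\<forall>i\<in>I. \<not> mono_cell I f (bump i u) i)
     \<and> \<not> mono_cell I f (bump k u) z}"

text \<open>Two cells charged to the same point share a corner, which would carry both their colours.\<close>

lemma card_nonmono_cells:
  fixes I :: "nat set"
  assumes "finite I" "k \<in> I" "z \<notin> I" "card I \<ge> 2"
    and no: "\<And>x. x \<in> lat I (Suc (Suc m)) \<Longrightarrow> f x \<in> I \<Longrightarrow> 0 < x (f x)"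
  shows "card {v \<in> lat I (Suc m). v k = 0 \<and> \<not> mono_cell I f v z} + card (unhit I k z f m)
    \<le> card {v \<in> lat I (Suc m). \<forall>a\<in>insert z I. \<not> mono_cell I f v a}"
proof -
  let ?D = "lat I (Suc m)"
  let ?M0 = "{v \<in> ?D. v k = 0 \<and> mono_cell I f v z}"
  let ?M1 = "{v \<in> ?D. (0 < v k \<and> mono_cell I f v z) \<or> (\<exists>a\<in>I. mono_cell I f v a)}"
  let ?N = "{v \<in> ?D. \<forall>a\<in>insert z I. \<not> mono_cell I f v a}"
  let ?H = "lat I m - unhit I k z f m"
  \<comment> \<open>The direction in which a monochromatic cell is charged: its own colour, or
    \<open>k\<close> if that colour is \<open>z\<close>. All corners agree, so the colour is read
    off at \<open>bump k v\<close>.\<close>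
  define c where "c v = (if f (bump k v) = z then k else f (bump k v))" for v
  define \<phi> where "\<phi> v = v(c v := v (c v) - 1)" for v
  have other: "\<exists>j\<in>I. j \<noteq> i" for i
    using assms(1,4) by (metis card_le_Suc0_iff_eq not_less_eq_eq numeral_2_eq_2)
  have M1: "bump (c v) (\<phi> v) = v \<and> \<phi> v \<in> ?H \<and> c v \<in> I
      \<and> (mono_cell I f v (c v) \<or> mono_cell I f v z \<and> c v = k)" if v: "v \<in> ?M1" for v
  proof -
    have cv: "c v \<in> I \<and> 0 < v (c v)
        \<and> (mono_cell I f v (c v) \<or> mono_cell I f v z \<and> c v = k)"
    proof (cases "\<exists>a\<in>I. mono_cell I f v a")
      case True
      then obtain a where a: "a \<in> I" "mono_cell I f v a" by blast
      obtain j where j: "j \<in> I" "j \<noteq> a" using other by blast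
      \<comment> \<open>A corner other than \<open>bump a v\<close> is labelled \<open>a\<close> and
        has the same \<open>a\<close>-th coordinate as \<open>v\<close>, so the support condition
        makes \<open>v a\<close> positive.\<close>
      have "f (bump j v) = a" using a j by (simp add: mono_cell_def)
      then have "0 < v a"
        using no[of "bump j v"] a j v assms(1) by (auto simp: bump_lat bump_apply)
      moreover have "c v = a" using a assms(2,3) by (auto simp: c_def mono_cell_def)
      ultimately show ?thesis using a by simp
    next
      case False
      then have "0 < v k" "mono_cell I f v z" using v by auto
      moreover have "c v = k" using \<open>mono_cell I f v z\<close> assms(2) by (auto simp: c_def mono_cell_def)
      ultimately show ?thesis using assms(2) by simp
    qed
    have b: "bump (c v) (\<phi> v) = v" using cv by (auto simp: bump_def \<phi>_def fun_eq_iff)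
    then have "\<phi> v \<in> lat I m" using v cv assms(1) by (metis (no_types, lifting) bump_lat mem_Collect_eq)
    moreover have "\<exists>i\<in>I. mono_cell I f (bump i (\<phi> v)) i"
      if "\<not> mono_cell I f (bump k (\<phi> v)) z"
      using b cv that by (intro bexI[of _ "c v"]) auto
    ultimately have "\<phi> v \<in> ?H" unfolding unhit_def by blast
    then show ?thesis using b cv by blast
  qed
  have "inj_on \<phi> ?M1"
  proof (rule inj_onI)
    fix v w assume vw: "v \<in> ?M1" "w \<in> ?M1" "\<phi> v = \<phi> w"
    let ?x = "bump (c w) v"
    have x: "?x = bump (c v) w" using M1[OF vw(1)] M1[OF vw(2)] vw(3) by (metis bump_commute)
    have "f ?x = c v \<or> f ?x = z \<and> c v = k"
      using M1[OF vw(1)] M1[OF vw(2)] by (auto simp: mono_cell_def)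
    moreover have "f ?x = c w \<or> f ?x = z \<and> c w = k"
      unfolding x using M1[OF vw(1)] M1[OF vw(2)] by (auto simp: mono_cell_def)
    moreover have "c v \<noteq> z" "c w \<noteq> z" using M1[OF vw(1)] M1[OF vw(2)] assms(3) by metis+
    ultimately have "c v = c w" by auto
    then show "v = w" using M1[OF vw(1)] M1[OF vw(2)] vw(3) by metis
  qed
  then have "card ?M1 \<le> card ?H"
    using M1 assms(1) by (intro card_inj_on_le[of \<phi>]) auto
  also have "card ?H = card (lat I m) - card (unhit I k z f m)"
    using assms(1) by (intro card_Diff_subset) (auto simp: unhit_def intro: finite_subset)
  finally have 1: "card ?M1 + card (unhit I k z f m) \<le> card (lat I m)"
    using card_mono[of "lat I m" "unhit I k z f m"] assms(1) by (auto simp: unhit_def)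
  \<comment> \<open>There are as many points of sum \<open>m\<close> as cells with positive
    \<open>k\<close>-th coordinate. After charging, the surplus of cells is therefore counted by
    those with \<open>v k = 0\<close>.\<close>
  have "card (lat I m) = card (bump k ` lat I m)"
    by (simp add: card_image inj_on_def bump_inject)
  also have "bump k ` lat I m = {v \<in> ?D. 0 < v k}"
  proof
    show "{v \<in> ?D. 0 < v k} \<subseteq> bump k ` lat I m"
    proof
      fix v assume v: "v \<in> {v \<in> ?D. 0 < v k}"
      then obtain u where "v = bump k u" using unbump[of v k] by blast
      then show "v \<in> bump k ` lat I m" using v assms(1,2) by (auto simp: bump_lat)
    qed
  qed (use assms(1,2) in \<open>auto simp: bump_lat bump_apply\<close>)
  finally have 2: "card (lat I m) = card {v \<in> ?D. 0 < v k}" .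
  have "card ?D = card {v \<in> ?D. 0 < v k} + card {v \<in> ?D. v k = 0}"
    using assms(1) by (subst card_Un_disjoint[symmetric]) (auto intro: arg_cong[where f = card])
  moreover have "card {v \<in> ?D. v k = 0} = card {v \<in> ?D. v k = 0 \<and> \<not> mono_cell I f v z} + card ?M0"
    using assms(1) by (subst card_Un_disjoint[symmetric]) (auto intro: arg_cong[where f = card])
  moreover have "card ?D \<le> card ?M1 + card ?M0 + card ?N"
  proof -
    have "?D \<subseteq> ?M1 \<union> ?M0 \<union> ?N" by auto
    then have "card ?D \<le> card (?M1 \<union> ?M0 \<union> ?N)" using assms(1) by (intro card_mono) auto
    also have "\<dots> \<le> card ?M1 + card ?M0 + card ?N" by (meson add_le_mono1 card_Un_le order_trans)
    finally show ?thesis .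
  qed
  ultimately show ?thesis using 1 2 by linarith
qed

section \<open>Labellings of the triangular face\<close>

definition tri :: "nat \<Rightarrow> nat \<Rightarrow> nat \<Rightarrow> nat \<Rightarrow> nat \<Rightarrow> nat \<Rightarrow> nat \<Rightarrow> nat" where
  "tri i j k a b c = (\<lambda>x. if x = i then a else if x = j then b else if x = k then c else 0)"

definition face_ix :: "nat set" where
  "face_ix = {1, 2, 3}"

lemma face_ix [simp]: "finite face_ix" "card face_ix = 3" "4 \<notin> face_ix" "5 \<notin> face_ix"
  by (simp_all add: face_ix_def)

text \<open>The face arguments are symmetric in the three corners; an arbitrary ordering lets each
  be written once.\<close>

definition perm3 :: "nat \<Rightarrow> nat \<Rightarrow> nat \<Rightarrow> bool" where
  "perm3 i j k \<longleftrightarrow> i \<noteq> j \<and> i \<noteq> k \<and> j \<noteq> k \<and> {i, j, k} = face_ix"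

abbreviation D3 :: "nat \<Rightarrow> (nat \<Rightarrow> nat) set" where
  "D3 \<equiv> lat face_ix"

lemma perm3_rotate: "perm3 i j k \<Longrightarrow> perm3 j k i"
  and perm3_swap: "perm3 i j k \<Longrightarrow> perm3 j i k"
  by (auto simp: perm3_def face_ix_def)

lemma perm3_extend:
  assumes "k \<in> face_ix" obtains i j where "perm3 i j k"
proof -
  have "perm3 2 3 1" "perm3 1 3 2" "perm3 1 2 3" by (auto simp: perm3_def face_ix_def)
  then show thesis using assms that by (auto simp: face_ix_def)
qed

lemma perm3_extend2:
  assumes "k \<in> face_ix" "i \<in> face_ix" "i \<noteq> k" obtains j where "perm3 i j k"
proof -
  obtain a b where "perm3 a b k" using perm3_extend assms(1) .
  then have "perm3 i a k \<or> perm3 i b k" using assms by (auto simp: perm3_def face_ix_def)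
  then show thesis using that by auto
qed

lemma perm3_mem:
  assumes "perm3 i j k"
  shows "i \<in> face_ix" "j \<in> face_ix" "k \<in> face_ix"
  using assms by (auto simp: perm3_def face_ix_def)

lemma perm3_set: "perm3 i j k \<Longrightarrow> face_ix = {i, j, k}"
  by (simp add: perm3_def)

lemma perm3_neq:
  assumes "perm3 i j k"
  shows "i \<noteq> j" "i \<noteq> k" "j \<noteq> k" "j \<noteq> i" "k \<noteq> i" "k \<noteq> j"
  using assms by (auto simp: perm3_def face_ix_def)

lemma perm3_lat:
  assumes "perm3 i j k"
  shows "x \<in> D3 m \<longleftrightarrow> (\<forall>l. l \<notin> {i, j, k} \<longrightarrow> x l = 0) \<and> x i + x j + x k = m"
  unfolding lat_def perm3_set[OF assms] using perm3_neq[OF assms] by (simp add: add.assoc)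

lemma tri_at:
  assumes "perm3 i j k"
  shows "tri i j k a b c i = a" "tri i j k a b c j = b" "tri i j k a b c k = c"
  using perm3_neq[OF assms] by (simp_all add: tri_def)

lemma tri_lat: "perm3 i j k \<Longrightarrow> tri i j k a b c \<in> D3 m \<longleftrightarrow> a + b + c = m"
  using tri_at[of i j k a b c] by (auto simp: perm3_lat) (simp add: tri_def)

lemma tri_eta:
  assumes "perm3 i j k" "x \<in> D3 m" shows "tri i j k (x i) (x j) (x k) = x"
  using assms(2) unfolding perm3_lat[OF assms(1)] by (auto simp: tri_def fun_eq_iff)

lemma tri_inject: "perm3 i j k \<Longrightarrow>
    tri i j k a b c = tri i j k a' b' c' \<longleftrightarrow> a = a' \<and> b = b' \<and> c = c'"
  by (metis tri_at)

lemma tri_bump: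
  assumes "perm3 i j k"
  shows "bump i (tri i j k a b c) = tri i j k (Suc a) b c"
    "bump j (tri i j k a b c) = tri i j k a (Suc b) c"
    "bump k (tri i j k a b c) = tri i j k a b (Suc c)"
  using perm3_neq[OF assms] by (auto simp: tri_def bump_def fun_eq_iff)

lemma tri_swap12: "perm3 i j k \<Longrightarrow> tri j i k b a c = tri i j k a b c"
  and tri_swap23: "perm3 i j k \<Longrightarrow> tri i k j a c b = tri i j k a b c"
  and tri_swap13: "perm3 i j k \<Longrightarrow> tri k j i c b a = tri i j k a b c"
  by (auto simp: tri_def perm3_def fun_eq_iff)

lemma mono_cell_perm3: "perm3 i j k \<Longrightarrow> mono_cell face_ix f v a \<longleftrightarrow>
    f (bump i v) = a \<and> f (bump j v) = a \<and> f (bump k v) = a"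
  by (auto simp: mono_cell_def perm3_set)

text \<open>Every edge of the face lies in exactly one cell. It is encoded as \<open>(v, k)\<close>: the edge of the
  cell \<open>v\<close> opposite to the corner \<open>bump k v\<close>, on which the \<open>k\<close>-th coordinate is constantly \<open>v k\<close>.\<close>

definition cut_edges :: "nat \<Rightarrow> ((nat \<Rightarrow> nat) \<Rightarrow> nat) \<Rightarrow> ((nat \<Rightarrow> nat) \<times> nat) set" where
  "cut_edges n f = {(v, k). v \<in> D3 (n - 1) \<and> k \<in> face_ix
     \<and> (\<exists>i\<in>face_ix - {k}. \<exists>j\<in>face_ix - {k}. f (bump i v) \<noteq> f (bump j v))}"

lemma cut_edges_iff: "perm3 i j k \<Longrightarrow>
    (v, k) \<in> cut_edges n f \<longleftrightarrow> v \<in> D3 (n - 1) \<and> f (bump i v) \<noteq> f (bump j v)"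
proof -
  assume p: "perm3 i j k"
  have "face_ix - {k} = {i, j}" "k \<in> face_ix"
    using perm3_set[OF p] perm3_neq[OF p] perm3_mem[OF p] by blast+
  then show ?thesis unfolding cut_edges_def by auto
qed

lemma finite_cut_edges [simp]: "finite (cut_edges n f)"
  by (rule finite_subset[of _ "D3 (n - 1) \<times> face_ix"]) (auto simp: cut_edges_def)

section \<open>Label changes along lines of the triangle\<close>

lemma change_between:
  fixes g :: "nat \<Rightarrow> 'a"
  assumes "a \<le> b" "g a \<noteq> g b"
  obtains s where "a \<le> s" "s < b" "g s \<noteq> g (Suc s)"
proof -
  have "\<exists>s. a \<le> s \<and> s < b \<and> g s \<noteq> g (Suc s)"
    using assms by (induction b rule: dec_induct) (metis less_Suc_eq, metis less_Suc_eq)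
  then show thesis using that by blast
qed

text \<open>Points with \<open>k\<close>-th coordinate \<open>t\<close> are numbered by their
  \<open>j\<close>-th coordinate. The edge between positions \<open>s\<close> and
  \<open>s + 1\<close> belongs to the cell \<open>(n - t - s - 1, s, t)\<close> and is opposite to
  its \<open>k\<close>-corner.\<close>

lemma line_cut:
  assumes p: "perm3 i j k" and "a \<le> b" "b + t \<le> n"
    and "f (tri i j k (n - t - a) a t) \<noteq> f (tri i j k (n - t - b) b t)"
  obtains s where "a \<le> s" "s < b" "(tri i j k (n - t - s - 1) s t, k) \<in> cut_edges n f"
proof -
  obtain s where s: "a \<le> s" "s < b"
      "f (tri i j k (n - t - s) s t) \<noteq> f (tri i j k (n - t - Suc s) (Suc s) t)"
    using change_between[of a b "\<lambda>s. f (tri i j k (n - t - s) s t)"] assms(2,4) by blast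
  have "Suc (n - t - s - 1) = n - t - s" "n - t - Suc s = n - t - s - 1"
    "n - t - s - 1 + s + t = n - 1" using s assms(3) by simp_all
  then have "(tri i j k (n - t - s - 1) s t, k) \<in> cut_edges n f"
    using s(3) unfolding cut_edges_iff[OF p] tri_lat[OF p] tri_bump[OF p] by metis
  then show thesis using that s by blast
qed

text \<open>A walk from label \<open>i\<close> to label \<open>j\<close> through a \<open>5\<close>
  changes label before the \<open>5\<close> and again after it.\<close>

lemma line_two_cuts:
  assumes p: "perm3 i j k" and z: "z \<in> D3 n" "f z = 5" "z k = t"
    and e: "f (tri i j k (n - t) 0 t) = i" "f (tri i j k 0 (n - t) t) = j"
  shows "2 \<le> card {(v, l) \<in> cut_edges n f. l = k \<and> v k = t}"
proof -
  let ?A = "{(v, l) \<in> cut_edges n f. l = k \<and> v k = t}"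
  define s where "s = z j"
  have s: "f (tri i j k (n - t - s) s t) = 5" "s \<le> n - t" "n - t + t \<le> n"
  proof -
    have zs: "z i + z j + z k = n" using z(1) perm3_lat[OF p] by simp
    then have "n - t - s = z i" using z(3) by (simp add: s_def)
    then show "f (tri i j k (n - t - s) s t) = 5" "s \<le> n - t" "n - t + t \<le> n"
      using z zs tri_eta[OF p z(1)] by (simp_all add: s_def)
  qed
  have ij: "i \<noteq> 5" "j \<noteq> 5" using perm3_mem[OF p] face_ix(4) by metis+
  then obtain a where a: "a < s" "(tri i j k (n - t - a - 1) a t, k) \<in> cut_edges n f"
    using line_cut[OF p, of 0 s t n f] s e by auto
  obtain b where b: "s \<le> b" "(tri i j k (n - t - b - 1) b t, k) \<in> cut_edges n f"
    using line_cut[OF p, of s "n - t" t n f] s e ij by auto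
  have "{(tri i j k (n - t - a - 1) a t, k), (tri i j k (n - t - b - 1) b t, k)} \<subseteq> ?A"
    using a b by (auto simp: tri_at[OF p])
  moreover have "finite ?A" by (rule finite_subset[OF _ finite_cut_edges]) auto
  moreover have "(tri i j k (n - t - a - 1) a t, k) \<noteq> (tri i j k (n - t - b - 1) b t, k)"
    using a b by (simp add: tri_inject[OF p])
  ultimately show ?thesis by (metis (no_types, lifting) card_2_iff card_mono)
qed

text \<open>A triangle with at least two colours has at least two bichromatic edges, and different
  cells share no edge in this encoding.\<close>

lemma card_cut_edges_ge:
  "2 * card {v \<in> D3 (n - 1). \<forall>a. \<not> mono_cell face_ix f v a} \<le> card (cut_edges n f)"
proof -
  let ?N = "{v \<in> D3 (n - 1). \<forall>a. \<not> mono_cell face_ix f v a}"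
  let ?K = "\<lambda>v. {k. (v, k) \<in> cut_edges n f}"
  have fin: "finite (?K v)" for v
    by (rule finite_subset[of _ "face_ix"]) (auto simp: cut_edges_def)
  have "2 \<le> card (?K v)" if v: "v \<in> ?N" for v
  proof -
    have "1 \<in> face_ix" by (simp add: face_ix_def)
    then obtain i j k where p: "perm3 i j k" using perm3_extend by blast
    note q = p perm3_rotate[OF p] perm3_rotate[OF perm3_rotate[OF p]]
    have "\<not> (f (bump i v) = f (bump j v) \<and> f (bump i v) = f (bump k v))"
      using v mono_cell_perm3[OF p, of f v "f (bump i v)"] by auto
    moreover have "l \<in> ?K v \<longleftrightarrow> f (bump a v) \<noteq> f (bump b v)" if "perm3 a b l" for a b l
      using v cut_edges_iff[OF that] by simp
    note this[OF q(1)] this[OF q(2)] this[OF q(3)]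
    ultimately obtain A where "A \<subseteq> ?K v" "card A = 2"
      using perm3_neq[OF p] card_2_iff by (metis empty_subsetI insert_subset)
    then show ?thesis using card_mono[OF fin] by metis
  qed
  then have "2 * card ?N \<le> (\<Sum>v\<in>?N. card (?K v))"
    using sum_mono[of ?N "\<lambda>_. 2" "\<lambda>v. card (?K v)"] by (simp add: mult.commute)
  also have "\<dots> = card (SIGMA v : ?N. ?K v)" using fin by simp
  also have "\<dots> \<le> card (cut_edges n f)" by (intro card_mono) auto
  finally show ?thesis .
qed

text \<open>This is what a non-opposite cut becomes on the face. The repaintings below satisfy the
  same axioms, so the locale can be interpreted again for them.\<close>

locale face_labelling =
  fixes h n :: nat and f :: "(nat \<Rightarrow> nat) \<Rightarrow> nat"
  assumes n: "n = 3 * h" and h: "0 < h"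
    and range: "\<And>x. x \<in> D3 n \<Longrightarrow> f x \<in> insert 5 face_ix"
    and support: "\<And>x. x \<in> D3 n \<Longrightarrow> f x \<noteq> 5 \<Longrightarrow> 0 < x (f x)"
    and corner: "\<And>i j k. perm3 i j k \<Longrightarrow> f (tri i j k n 0 0) = i"
begin

abbreviation missed where "missed k \<equiv> unhit face_ix k 5 f (n - 2)"

text \<open>Cells labelled \<open>5\<close> are charged in the direction \<open>k\<close>. The
  \<open>n\<close> cells with \<open>v k = 0\<close> touch the side free of \<open>5\<close>, so
  none of them is entirely \<open>5\<close>; together with the uncharged points they bound the
  number of non-monochromatic triangles from below.\<close>

lemma card_cut_edges_no5:
  assumes k: "k \<in> face_ix" and no5: "\<And>x. x \<in> D3 n \<Longrightarrow> x k = 0 \<Longrightarrow> f x \<noteq> 5"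
  shows "2 * (n + card (missed k)) \<le> card (cut_edges n f)"
proof -
  obtain i j where p: "perm3 i j k" using perm3_extend k .
  have n2: "Suc (n - 2) = n - 1" "Suc (n - 1) = n" using n h by auto
  have bl: "bump l v \<in> D3 n \<longleftrightarrow> v \<in> D3 (n - 1)" if "l \<in> face_ix" for l v
    using that n2 bump_lat[of "face_ix" l v "n - 1"] by simp
  have "card {v \<in> D3 (n - 1). v k = 0 \<and> \<not> mono_cell face_ix f v 5} + card (missed k)
    \<le> card {v \<in> D3 (n - 1). \<forall>a\<in>insert 5 face_ix. \<not> mono_cell face_ix f v a}"
  proof -
    have "\<And>x. x \<in> D3 (Suc (Suc (n - 2))) \<Longrightarrow> f x \<in> face_ix \<Longrightarrow> 0 < x (f x)"
      using support face_ix(4) unfolding n2 by metis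
    then show ?thesis using card_nonmono_cells[OF face_ix(1) k face_ix(4), of "n - 2" f]
      unfolding n2 by simp
  qed
  moreover have "n \<le> card {v \<in> D3 (n - 1). v k = 0 \<and> \<not> mono_cell face_ix f v 5}"
  proof -
    have "(\<lambda>s. tri i j k (n - 1 - s) s 0) ` {..<n}
      \<subseteq> {v \<in> D3 (n - 1). v k = 0 \<and> \<not> mono_cell face_ix f v 5}"
      using no5 p n2 by (auto simp: tri_lat tri_at mono_cell_perm3 tri_bump)
    moreover have "inj_on (\<lambda>s. tri i j k (n - 1 - s) s 0) {..<n}"
      using p by (auto simp: inj_on_def tri_inject)
    ultimately show ?thesis using card_inj_on_le[of _ "{..<n}"] by force
  qed
  moreover have "{v \<in> D3 (n - 1). \<forall>a\<in>insert 5 face_ix. \<not> mono_cell face_ix f v a}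
    = {v \<in> D3 (n - 1). \<forall>a. \<not> mono_cell face_ix f v a}"
    using range bl by (fastforce simp: mono_cell_def)
  ultimately show ?thesis using card_cut_edges_ge[of n f] by simp
qed

section \<open>Connected sets of label 5\<close>

definition adj5 :: "((nat \<Rightarrow> nat) \<times> (nat \<Rightarrow> nat)) set" where
  "adj5 = {(x, y). x \<in> D3 n \<and> y \<in> D3 n \<and> f x = 5 \<and> f y = 5
     \<and> (\<exists>v i j. x = bump i v \<and> y = bump j v)}"

text \<open>A step of \<open>adj5\<close> raises a coordinate by at most one, so a path cannot jump
  over the value \<open>t\<close>.\<close>

lemma adj5_connects:
  assumes "(x, y) \<in> adj5\<^sup>*" "x k \<le> t" "t \<le> y k"
  shows "\<exists>z. (x, z) \<in> adj5\<^sup>* \<and> z k = t"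
  using assms
proof (induction rule: rtrancl_induct)
  case base
  then show ?case by (intro exI[of _ x]) auto
next
  case (step y z)
  have "z k \<le> Suc (y k)" using step.hyps(2) by (auto simp: adj5_def bump_apply split: if_splits)
  then consider "t \<le> y k" | "t = z k" using step.prems by linarith
  then show ?case using step by cases (auto intro: rtrancl_into_rtrancl)
qed

lemma sym_adj5: "sym (adj5\<^sup>*)"
  by (rule sym_rtrancl) (auto simp: sym_def adj5_def)

lemma adj5_closed: "(x, y) \<in> adj5\<^sup>* \<Longrightarrow> x \<in> D3 n \<Longrightarrow> f x = 5 \<Longrightarrow> y \<in> D3 n \<and> f y = 5"
  by (induction rule: rtrancl_induct) (auto simp: adj5_def)

end

locale filled_labelling = face_labelling +
  assumes filled: "\<And>x i. x \<in> D3 n \<Longrightarrow> i \<in> face_ix \<Longrightarrow> 2 * h < x i \<Longrightarrow> f x = i"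
begin

text \<open>Each of the \<open>3 * h = n\<close> lines with \<open>k\<close>-th coordinate
  \<open>t < h\<close> is cut twice: its ends lie in filled corners, and the component of
  \<open>x\<close> meets it.\<close>

lemma card_cut_edges_tripod:
  assumes x: "x \<in> D3 n" "f x = 5"
    and touch: "\<And>k. k \<in> face_ix \<Longrightarrow> \<exists>y. (x, y) \<in> adj5\<^sup>* \<and> y k = 0"
  shows "2 * n \<le> card (cut_edges n f)"
proof -
  let ?A = "\<lambda>(k, t). {(v, l) \<in> cut_edges n f. l = k \<and> v k = t}"
  have "2 \<le> card (?A (k, t))" if k: "k \<in> face_ix" and t: "t < h" for k t
  proof -
    obtain i j where p: "perm3 i j k" using perm3_extend k .
    note pp = perm3_mem[OF p] perm3_neq[OF p]
    obtain y0 where y0: "(x, y0) \<in> adj5\<^sup>*" "y0 k = 0" using touch k by blast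
    obtain y1 where y1: "(x, y1) \<in> adj5\<^sup>*" "y1 i = 0" using touch pp(1) by blast
    have y1': "y1 \<in> D3 n" "f y1 = 5" using adj5_closed y1(1) x by blast+
    \<comment> \<open>\<open>y1\<close> is labelled \<open>5\<close>, so it lies outside the filled
      corner \<open>j\<close>. As \<open>y1 i = 0\<close>, its \<open>k\<close>-th coordinate is at
      least \<open>n - 2 * h = h\<close>, beyond the line sought.\<close>
    have "y1 j \<le> 2 * h" using filled[OF y1'(1) pp(2)] y1'(2) pp(2) by force
    then have "h \<le> y1 k" using y1 y1'(1) n perm3_lat[OF p] by simp
    have "\<exists>z. (x, z) \<in> adj5\<^sup>* \<and> z k = t"
    proof (cases "x k \<le> t")
      case True
      then show ?thesis using adj5_connects y1(1) \<open>h \<le> y1 k\<close> t by (meson less_imp_le order_trans)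
    next
      case False
      have "(y0, x) \<in> adj5\<^sup>*" using y0(1) sym_adj5 by (meson symD)
      then obtain z where "(y0, z) \<in> adj5\<^sup>*" "z k = t" using adj5_connects[of y0 x k t] y0 False by force
      then show ?thesis using rtrancl_trans[OF y0(1)] by blast
    qed
    then obtain z where z: "z \<in> D3 n" "f z = 5" "z k = t" using adj5_closed x by blast
    have "f (tri i j k (n - t) 0 t) = i" "f (tri i j k 0 (n - t) t) = j"
      using t n by (auto intro!: filled pp simp: tri_lat[OF p] tri_at[OF p])
    then show ?thesis using line_two_cuts[where f = f, OF p z] by simp
  qed
  then have "(\<Sum>x\<in>face_ix \<times> {..<h}. 2) \<le> (\<Sum>x\<in>face_ix \<times> {..<h}. card (?A x))"
    by (intro sum_mono) auto
  also have "\<dots> = card (\<Union>x\<in>face_ix \<times> {..<h}. ?A x)"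
    by (rule card_UN_disjoint[symmetric]) (auto intro: finite_subset[OF _ finite_cut_edges])
  also have "\<dots> \<le> card (cut_edges n f)" by (intro card_mono) auto
  finally show ?thesis using n by (simp add: card_cartesian_product)
qed

text \<open>If no component of \<open>5\<close>s touches all sides, colouring each by the index of a
  side it avoids respects supports, cuts nothing new and removes the label \<open>5\<close>.\<close>

lemma card_cut_edges_filled: "2 * n \<le> card (cut_edges n f)"
proof (cases "\<exists>x\<in>D3 n. f x = 5 \<and> (\<forall>k\<in>face_ix. \<exists>y. (x, y) \<in> adj5\<^sup>* \<and> y k = 0)")
  case True
  then obtain x where x: "x \<in> D3 n" "f x = 5" "\<forall>k\<in>face_ix. \<exists>y. (x, y) \<in> adj5\<^sup>* \<and> y k = 0"
    by blast
  show ?thesis by (rule card_cut_edges_tripod[OF x(1,2)]) (rule x(3)[rule_format])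
next
  case False
  \<comment> \<open>A side avoided by the component of \<open>x\<close>. The choice depends on
    \<open>x\<close> only through the set of points reachable from it, so adjacent \<open>5\<close>s
    receive the same colour.\<close>
  define c where "c x = (SOME k. k \<in> face_ix \<and> (\<forall>y. (x, y) \<in> adj5\<^sup>* \<longrightarrow> 0 < y k))" for x
  define g where "g x = (if f x = 5 then c x else f x)" for x
  have c: "c x \<in> face_ix \<and> 0 < x (c x)" if "x \<in> D3 n" "f x = 5" for x
  proof -
    have "\<exists>k. k \<in> face_ix \<and> (\<forall>y. (x, y) \<in> adj5\<^sup>* \<longrightarrow> 0 < y k)"
      using False that by (metis gr0I)
    then have "c x \<in> face_ix \<and> (\<forall>y. (x, y) \<in> adj5\<^sup>* \<longrightarrow> 0 < y (c x))"
      unfolding c_def by (rule someI_ex)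
    then show ?thesis by blast
  qed
  have g: "x \<in> D3 n \<Longrightarrow> g x \<in> face_ix \<and> 0 < x (g x)" for x
    using c range support unfolding g_def by fastforce
  interpret g: face_labelling h n g
  proof
    show "g (tri i j k n 0 0) = i" if "perm3 i j k" for i j k
      using corner[OF that] perm3_mem[OF that] by (auto simp: g_def)
  qed (use n h g in auto)
  have "cut_edges n g \<subseteq> cut_edges n f"
  proof (clarify)
    fix v k assume vk: "(v, k) \<in> cut_edges n g"
    then obtain i j where p: "perm3 i j k" using perm3_extend unfolding cut_edges_def by blast
    have v: "v \<in> D3 (n - 1)" "g (bump i v) \<noteq> g (bump j v)" using vk cut_edges_iff[OF p] by auto
    have D: "bump i v \<in> D3 n" "bump j v \<in> D3 n"
      using v(1) n h perm3_mem[OF p] bump_lat[of "face_ix" _ v "n - 1"] by auto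
    have "f (bump i v) \<noteq> f (bump j v)"
    proof
      assume eq: "f (bump i v) = f (bump j v)"
      then have 5: "f (bump i v) = 5" "f (bump j v) = 5" using v(2) by (auto simp: g_def split: if_splits)
      then have e: "(bump i v, bump j v) \<in> adj5" "(bump j v, bump i v) \<in> adj5"
        using D by (auto simp: adj5_def)
      then have "(bump i v, y) \<in> adj5\<^sup>* \<longleftrightarrow> (bump j v, y) \<in> adj5\<^sup>*" for y
        using converse_rtrancl_into_rtrancl[OF e(1), of y] converse_rtrancl_into_rtrancl[OF e(2), of y]
        by blast
      then have "c (bump i v) = c (bump j v)" by (simp add: c_def)
      then show False using v(2) 5 by (simp add: g_def)
    qed
    then show "(v, k) \<in> cut_edges n f" using v(1) by (simp add: cut_edges_iff[OF p])
  qed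
  then have "card (cut_edges n g) \<le> card (cut_edges n f)" by (intro card_mono) auto
  moreover have "2 * (n + card (g.missed 1)) \<le> card (cut_edges n g)"
    using g.card_cut_edges_no5[of 1] g by (force simp: face_ix_def)
  ultimately show ?thesis by simp
qed

end

section \<open>Repainting the corners\<close>

text \<open>On \<open>D3 n\<close> with \<open>n = 3 * h > 0\<close> at most one coordinate exceeds
  \<open>2 * h\<close>, so the choice is forced there.\<close>

definition fill :: "nat \<Rightarrow> ((nat \<Rightarrow> nat) \<Rightarrow> nat) \<Rightarrow> (nat \<Rightarrow> nat) \<Rightarrow> nat" where
  "fill h f x = (if \<exists>i\<in>face_ix. 2 * h < x i then (SOME i. i \<in> face_ix \<and> 2 * h < x i) else f x)"

text \<open>\<open>wt h v k\<close> is the weight of the edge \<open>(v, k)\<close> in \<open>J\<close>, divided by \<open>rho\<close>, for \<open>n = 3 h\<close>; the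
  truncated subtraction vanishes outside the ranks \<open>t = n - v i \<le> h\<close>.\<close>

definition wt :: "nat \<Rightarrow> (nat \<Rightarrow> nat) \<Rightarrow> nat \<Rightarrow> nat" where
  "wt h v k = (if v k = 0 then 1 + (\<Sum>i\<in>face_ix - {k}. v i - 2 * h)
     else if v k \<le> 2 * h then 1 else 0)"

lemma two_large:
  assumes "x \<in> D3 m" "m \<le> 3 * h" "0 < h" "i \<in> face_ix" "j \<in> face_ix" "2 * h \<le> x i" "2 * h \<le> x j"
  shows "i = j"
proof (rule ccontr)
  assume "i \<noteq> j"
  then obtain k where p: "perm3 i k j" using perm3_extend2 assms by metis
  show False using assms perm3_lat[OF p, of x m] by simp
qed

context face_labelling
begin

lemma bump_D3: "l \<in> face_ix \<Longrightarrow> bump l v \<in> D3 n \<longleftrightarrow> v \<in> D3 (n - 1)"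
  using bump_lat[of face_ix l v "n - 1"] n h by simp

lemma fill_top:
  assumes "x \<in> D3 n" "i \<in> face_ix" "2 * h < x i"
  shows "fill h f x = i"
proof -
  have "(SOME i. i \<in> face_ix \<and> 2 * h < x i) \<in> face_ix
      \<and> 2 * h < x (SOME i. i \<in> face_ix \<and> 2 * h < x i)"
    by (rule someI[of _ i]) (use assms in auto)
  then have "(SOME i. i \<in> face_ix \<and> 2 * h < x i) = i"
    using two_large[OF assms(1), of h] assms n h by auto
  then show ?thesis using assms by (auto simp: fill_def)
qed

lemma fill_else: "(\<And>i. i \<in> face_ix \<Longrightarrow> x i \<le> 2 * h) \<Longrightarrow> fill h f x = f x"
  by (metis (no_types, lifting) fill_def not_less)

lemma fill_cases:
  obtains i where "i \<in> face_ix" "2 * h < x i" | "\<And>i. i \<in> face_ix \<Longrightarrow> x i \<le> 2 * h" "fill h f x = f x"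
  using fill_else not_less by metis

lemma filled_labelling_fill: "filled_labelling h n (fill h f)"
proof
  show "fill h f x \<in> insert 5 face_ix" if "x \<in> D3 n" for x
    by (rule fill_cases[of x]) (use that fill_top range in auto)
  show "0 < x (fill h f x)" if "x \<in> D3 n" "fill h f x \<noteq> 5" for x
    by (rule fill_cases[of x]) (use that fill_top support in force)+
  show "fill h f (tri i j k n 0 0) = i" if p: "perm3 i j k" for i j k
    by (rule fill_top) (use n h perm3_mem[OF p] in \<open>auto simp: tri_lat[OF p] tri_at[OF p]\<close>)
qed (use n h fill_top in auto)

text \<open>The weight split into units: \<open>(0, 0)\<close> stands for the basic weight \<open>1\<close>, and a side edge of rank
  at most \<open>t\<close> at the corner \<open>c\<close> has one more unit for every row \<open>t < h\<close> of \<open>T_c\<close>. That unit replaces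
  the row edges of cost \<open>0\<close>.\<close>

definition units :: "(((nat \<Rightarrow> nat) \<times> nat) \<times> nat \<times> nat) set" where
  "units = (SIGMA vk : cut_edges n f. {(0, 0) | _ :: nat. fst vk (snd vk) \<le> 2 * h}
     \<union> {(c, t). fst vk (snd vk) = 0 \<and> c \<in> face_ix - {snd vk} \<and> n - fst vk c \<le> t \<and> t < h})"

lemma finite_units: "finite units" and card_units: "card units = (\<Sum>(v, k)\<in>cut_edges n f. wt h v k)"
proof -
  let ?B = "\<lambda>vk. {(0::nat, 0::nat) | _ :: nat. fst vk (snd vk) \<le> 2 * h}"
  let ?C = "\<lambda>vk. {(c, t). fst vk (snd vk) = 0 \<and> c \<in> face_ix - {snd vk} \<and> n - fst vk c \<le> t \<and> t < h}"
  have C: "?C vk = (if fst vk (snd vk) = 0 then SIGMA c : face_ix - {snd vk}. {n - fst vk c..<h} else {})" for vk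
    by auto
  have fin: "finite (?B vk)" "finite (?C vk)" for vk
    unfolding C by (auto intro: finite_subset[of _ "{(0, 0)}"])
  show "finite units" unfolding units_def using fin by (intro finite_SigmaI) auto
  have "card (?B (v, k) \<union> ?C (v, k)) = wt h v k" if "(v, k) \<in> cut_edges n f" for v k
  proof -
    have "?B (v, k) \<inter> ?C (v, k) = {}" by (auto simp: face_ix_def)
    then have "card (?B (v, k) \<union> ?C (v, k)) = card (?B (v, k)) + card (?C (v, k))"
      using fin by (intro card_Un_disjoint)
    also have "card (?B (v, k)) = (if v k \<le> 2 * h then 1 else 0)" by auto
    also have "card (?C (v, k)) = (if v k = 0 then \<Sum>c\<in>face_ix - {k}. v c - 2 * h else 0)"
    proof -
      have "v c \<le> n - 1" if "c \<in> face_ix" for c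
        using \<open>(v, k) \<in> _\<close> member_le_sum[of c face_ix v] that by (auto simp: cut_edges_def lat_def)
      then have "h - (n - v c) = v c - 2 * h" if "c \<in> face_ix" for c using n h that by fastforce
      then show ?thesis unfolding C by auto
    qed
    finally show ?thesis by (simp add: wt_def)
  qed
  then have "(\<Sum>vk\<in>cut_edges n f. card (?B vk \<union> ?C vk)) = (\<Sum>(v, k)\<in>cut_edges n f. wt h v k)"
    by (intro sum.cong) auto
  then show "card units = (\<Sum>(v, k)\<in>cut_edges n f. wt h v k)"
    unfolding units_def using fin by (subst card_SigmaI) auto
qed

text \<open>On the line through \<open>T_c\<close> with \<open>d\<close>-th coordinate \<open>t\<close> there is a \<open>5\<close>, but not at the first point
  below \<open>T_c\<close>. The line then contains one cut edge more than repainting needs.\<close>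

definition slack :: "nat \<Rightarrow> nat \<Rightarrow> nat \<Rightarrow> nat \<Rightarrow> bool" where
  "slack c d e t \<longleftrightarrow> t < h \<and> f (tri c d e (2 * h) t (h - t)) \<noteq> 5
     \<and> (\<exists>s>0. s \<le> h - t \<and> f (tri c d e (2 * h + s) t (h - t - s)) = 5)"

text \<open>The units on a path from the corner \<open>c\<close> to the first point below
  \<open>T_c\<close> in row \<open>t\<close>: first side edges of rank at most \<open>t\<close>
  towards \<open>d\<close>, through their units tagged \<open>(c, t)\<close>, then the edges of the
  row.\<close>

definition corner_units :: "nat \<Rightarrow> nat \<Rightarrow> nat \<Rightarrow> (((nat \<Rightarrow> nat) \<times> nat) \<times> nat \<times> nat) set" where
  "corner_units c d t = {((v, l), a, b) \<in> units.
     a = 0 \<and> l = d \<and> v d = t \<and> 2 * h \<le> v c \<or> a = c \<and> b = t \<and> l \<noteq> d}"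

text \<open>The path of \<open>corner_units\<close> starts with label \<open>c\<close>, so it
  changes label if it ends with another one. Under \<open>slack\<close> it passes a \<open>5\<close>
  and does not end with \<open>5\<close>, which gives a change before and a change after.\<close>

lemma corner_units_ge:
  assumes p: "perm3 c d e" and t: "t < h"
  shows "of_bool (f (tri c d e (2 * h) t (h - t)) \<noteq> c) + of_bool (slack c d e t)
    \<le> card (corner_units c d t)"
proof -
  have p': "perm3 c e d" using p by (auto simp: perm3_def)
  note pp = perm3_mem[OF p] perm3_neq[OF p]
  have c0: "c \<noteq> 0" "c \<noteq> 5" using pp(1) by (auto simp: face_ix_def)
  \<comment> \<open>Row positions are numbered by the \<open>e\<close>-th coordinate: position
    \<open>0\<close> is on the side joining \<open>c\<close> and \<open>d\<close>, position
    \<open>h - t\<close> is the first point below \<open>T_c\<close>. \<open>B s\<close> is the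
    basic unit of the edge from \<open>s\<close> to \<open>s + 1\<close>.\<close>
  define q where "q s = f (tri c e d (n - t - s) s t)" for s
  define B where "B s = ((tri c e d (n - t - s - 1) s t, d), 0::nat, 0::nat)" for s
  let ?X = "corner_units c d t"
  have fin: "finite ?X" by (rule finite_subset[OF _ finite_units]) (auto simp: corner_units_def)
  have base: "\<exists>s\<ge>a. s < b \<and> B s \<in> ?X" if ab: "a \<le> b" "b \<le> h - t" "q a \<noteq> q b" for a b
  proof -
    have "b + t \<le> n" using ab t n by linarith
    then obtain s where s: "a \<le> s" "s < b" "(tri c e d (n - t - s - 1) s t, d) \<in> cut_edges n f"
      using line_cut[OF p' ab(1) _ ab(3)[unfolded q_def]] by blast
    moreover have "2 * h \<le> n - t - s - 1" "t \<le> 2 * h" using s ab t n by linarith+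
    ultimately have "B s \<in> ?X" by (simp add: B_def corner_units_def units_def tri_at[OF p'])
    then show ?thesis using s by blast
  qed
  have top: "\<exists>u\<in>?X. \<forall>s\<ge>b. u \<noteq> B s" if b: "b \<le> h - t" "q b \<noteq> c" for b
  proof (cases "q 0 = c")
    case True
    then obtain s where "s < b" "B s \<in> ?X" using base[of 0 b] b by auto
    then show ?thesis by (intro bexI[of _ "B s"]) (auto simp: B_def tri_inject[OF p'])
  next
    case False
    have "tri c e d (n - t) 0 t = tri c d e (n - t) t 0" using tri_swap23[OF p] .
    then have q0: "f (tri c d e (n - t) t 0) \<noteq> c" using False by (simp add: q_def)
    then obtain s where s: "s < t" "(tri c d e (n - s - 1) s 0, e) \<in> cut_edges n f"
      using line_cut[OF p, of 0 t 0 n f] corner[OF p] t n by auto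
    \<comment> \<open>The label already changes on the side, before the row begins. That edge has
      rank \<open>s + 1 \<le> t\<close>, so it owns the unit \<open>(c, t)\<close>.\<close>
    have "n - (n - s - 1) \<le> t" using s(1) t n by linarith
    then have "((tri c d e (n - s - 1) s 0, e), c, t) \<in> ?X"
      using s(2) t pp by (simp add: corner_units_def units_def tri_at[OF p])
    then show ?thesis by (rule bexI[rotated]) (auto simp: B_def c0)
  qed
  have y: "q (h - t) = f (tri c d e (2 * h) t (h - t))"
  proof -
    have "n - t - (h - t) = 2 * h" using t n by simp
    then show ?thesis by (simp add: q_def tri_swap23[OF p])
  qed
  show ?thesis
  proof (cases "slack c d e t")
    case True
    then obtain s where s: "0 < s" "s \<le> h - t" "f (tri c d e (2 * h + s) t (h - t - s)) = 5"
      and y5: "q (h - t) \<noteq> 5" using y by (auto simp: slack_def)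
    let ?b = "h - t - s"
    have "n - t - ?b = 2 * h + s" using s t n by simp
    then have q5: "q ?b = 5" using s by (simp add: q_def tri_swap23[OF p])
    have "?b \<le> h - t" by simp
    then obtain a where a: "?b \<le> a" "B a \<in> ?X" using base[of ?b "h - t"] q5 y5 by auto
    obtain u where "u \<in> ?X" "\<forall>s\<ge>?b. u \<noteq> B s"
      using top[OF \<open>?b \<le> h - t\<close>] q5 c0(2) by metis
    then have "{u, B a} \<subseteq> ?X" "u \<noteq> B a" using a by auto
    then have "2 \<le> card ?X" using card_mono[OF fin, of "{u, B a}"] by simp
    then show ?thesis by (auto split: if_splits simp: of_bool_def)
  next
    case False
    have "1 \<le> card ?X" if "q (h - t) \<noteq> c"
      using top[of "h - t"] that fin by (auto simp: Suc_le_eq card_gt_0_iff)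
    then show ?thesis using False y by auto
  qed
qed

abbreviation lines :: "(nat \<times> nat \<times> nat \<times> nat) set" where
  "lines \<equiv> {(c, d, e, t). perm3 c d e \<and> t < h}"

lemma finite_lines: "finite lines"
  by (rule finite_subset[of _ "face_ix \<times> face_ix \<times> face_ix \<times> {..<h}"]) (use perm3_mem in auto)

text \<open>After repainting, a cut edge either was cut before and has no end in a repainted region,
  or leads from \<open>T_c\<close> to a point of the row \<open>x c = 2 * h\<close> not labelled
  \<open>c\<close>. The latter kind is indexed by that point and the direction \<open>d\<close> of
  the line.\<close>

lemma card_cut_edges_fill:
  "card (cut_edges n (fill h f)) \<le>
     card {(v, k) \<in> cut_edges n f. v k \<le> 2 * h \<and> (\<forall>i\<in>face_ix - {k}. v i < 2 * h)}
     + card {(c, d, e, t) \<in> lines. f (tri c d e (2 * h) t (h - t)) \<noteq> c}"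
proof -
  let ?O = "{(v, k) \<in> cut_edges n f. v k \<le> 2 * h \<and> (\<forall>i\<in>face_ix - {k}. v i < 2 * h)}"
  let ?Y = "{(c, d, e, t) \<in> lines. f (tri c d e (2 * h) t (h - t)) \<noteq> c}"
  let ?g = "\<lambda>(c, d, e, t). (tri c d e (2 * h) t (h - 1 - t), d)"
  have "cut_edges n (fill h f) \<subseteq> ?O \<union> ?g ` ?Y"
  proof (clarify)
    fix v k assume vk: "(v, k) \<in> cut_edges n (fill h f)" and no: "(v, k) \<notin> ?g ` ?Y"
    then have v: "v \<in> D3 (n - 1)" and k: "k \<in> face_ix" by (auto simp: cut_edges_def)
    have D: "bump l v \<in> D3 n" if "l \<in> face_ix" for l using bump_D3 that v by simp
    have small: "v c < 2 * h" if c: "c \<in> face_ix" "c \<noteq> k" for c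
    proof (rule ccontr)
      assume "\<not> v c < 2 * h"
      then have vc: "2 * h \<le> v c" by simp
      obtain e where p: "perm3 c e k" using perm3_extend2 c k by metis
      then have p': "perm3 c k e" by (auto simp: perm3_def)
      note pp = perm3_mem[OF p] perm3_neq[OF p]
      have sm: "v c + v e + v k = n - 1" using v perm3_lat[OF p] by simp
      have "fill h f (bump c v) = c" using vc pp D by (intro fill_top) (auto simp: bump_apply)
      then have ne: "fill h f (bump e v) \<noteq> c" using vk cut_edges_iff[OF p] by metis
      have "v c = 2 * h"
      proof (rule ccontr)
        assume "v c \<noteq> 2 * h"
        then have "fill h f (bump e v) = c"
          using vc pp D by (intro fill_top) (auto simp: bump_apply)
        then show False using ne by simp
      qed
      then have s: "v e = h - 1 - v k" "v k < h" "Suc (v e) = h - v k" using sm n h by auto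
      have "bump e v l \<le> 2 * h" if "l \<in> face_ix" for l
        using that s \<open>v c = 2 * h\<close> by (auto simp: bump_apply perm3_set[OF p])
      then have "fill h f (bump e v) = f (bump e v)" by (rule fill_else)
      moreover have "v = tri c k e (2 * h) (v k) (h - 1 - v k)"
        using tri_eta[OF p' v] \<open>v c = 2 * h\<close> s by simp
      moreover from this have "bump e v = tri c k e (2 * h) (v k) (h - v k)"
        using tri_bump(3)[OF p', of "2 * h" "v k" "h - 1 - v k"] s by simp
      ultimately have "(c, k, e, v k) \<in> ?Y" "(v, k) = ?g (c, k, e, v k)"
        using ne p' s by auto
      then show False using no by (metis (no_types, lifting) imageI)
    qed
    obtain i j where p: "perm3 i j k" using perm3_extend k .
    note pp = perm3_mem[OF p] perm3_neq[OF p]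
    have vk2: "v k \<le> 2 * h"
    proof (rule ccontr)
      assume "\<not> v k \<le> 2 * h"
      then have "fill h f (bump i v) = k" "fill h f (bump j v) = k"
        using pp D by (auto intro!: fill_top simp: bump_apply)
      then show False using vk cut_edges_iff[OF p] by metis
    qed
    have "fill h f (bump l v) = f (bump l v)" if "l \<in> {i, j}" for l
      using that less_imp_le[OF small] small pp vk2 by (intro fill_else) (auto simp: bump_apply perm3_set[OF p] Suc_le_eq)
    then have "(v, k) \<in> cut_edges n f" using vk cut_edges_iff[OF p] by auto
    then show "(v, k) \<in> cut_edges n f \<and> v k \<le> 2 * h \<and> (\<forall>i\<in>face_ix - {k}. v i < 2 * h)"
      using vk2 small by auto
  qed
  moreover have fin: "finite ?O" "finite ?Y"
    by (auto intro: finite_subset[OF _ finite_cut_edges] finite_subset[OF _ finite_lines])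
  ultimately have "card (cut_edges n (fill h f)) \<le> card (?O \<union> ?g ` ?Y)" by (intro card_mono) auto
  also have "\<dots> \<le> card ?O + card ?Y"
    using card_Un_le[of ?O "?g ` ?Y"] card_image_le[OF fin(2), of ?g] by linarith
  finally show ?thesis .
qed

text \<open>An edge away from the corners keeps its basic unit; an edge leaving a repainted corner
  along row \<open>t\<close> is paid by the path of that row. Different paths share no unit, and
  slack rows have one to spare.\<close>

lemma weight_ge_fill:
  "card (cut_edges n (fill h f)) + card {(c, d, e, t) \<in> lines. slack c d e t}
     \<le> (\<Sum>(v, k)\<in>cut_edges n f. wt h v k)"
proof -
  let ?O = "{(v, k) \<in> cut_edges n f. v k \<le> 2 * h \<and> (\<forall>i\<in>face_ix - {k}. v i < 2 * h)}"
  let ?X = "\<lambda>(c, d, e :: nat, t). corner_units c d t"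
  let ?o = "(\<lambda>vk. (vk, 0::nat, 0::nat)) ` ?O"
  have finX: "finite (?X l)" for l
    by (rule finite_subset[OF _ finite_units]) (auto simp: corner_units_def)
  have "of_bool (f (tri c d e (2 * h) t (h - t)) \<noteq> c) + of_bool (slack c d e t)
      \<le> card (?X (c, d, e, t))" if "(c, d, e, t) \<in> lines" for c d e t
    using corner_units_ge that by simp
  then have "(\<Sum>(c, d, e, t)\<in>lines. of_bool (f (tri c d e (2 * h) t (h - t)) \<noteq> c)
      + of_bool (slack c d e t)) \<le> (\<Sum>l\<in>lines. card (?X l))"
    by (intro sum_mono) auto
  moreover have "(\<Sum>(c, d, e, t)\<in>lines. of_bool (f (tri c d e (2 * h) t (h - t)) \<noteq> c)
      + of_bool (slack c d e t))
    = card {(c, d, e, t) \<in> lines. f (tri c d e (2 * h) t (h - t)) \<noteq> c}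
      + card {(c, d, e, t) \<in> lines. slack c d e t}"
    using finite_lines
    by (simp add: case_prod_unfold sum.distrib sum_of_bool_eq Collect_conj_eq[symmetric] Int_def
        cong: conj_cong)
  moreover have "(\<Sum>l\<in>lines. card (?X l)) = card (\<Union>l\<in>lines. ?X l)"
  proof (rule card_UN_disjoint[symmetric])
    show "\<forall>l\<in>lines. \<forall>l'\<in>lines. l \<noteq> l' \<longrightarrow> ?X l \<inter> ?X l' = {}"
    proof (intro ballI impI)
      fix x x' assume xx: "x \<in> lines" "x' \<in> lines" "x \<noteq> x'"
      obtain c d e t c' d' e' t' where x: "x = (c, d, e, t)" "x' = (c', d', e', t')"
        by (cases x, cases x') auto
      then have p: "perm3 c d e" and p': "perm3 c' d' e'"
        and ne: "(c, d, e, t) \<noteq> (c', d', e', t')" using xx by auto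
      note pp = perm3_mem[OF p] perm3_neq[OF p] perm3_mem[OF p'] perm3_neq[OF p']
      have det: "e = e'" if "c = c'" "d = d'" using p p' that by (auto simp: perm3_def)
      \<comment> \<open>An extra unit names \<open>c\<close> and \<open>t\<close> in its tag. Its
        side \<open>l\<close>, different from \<open>c\<close> and \<open>d\<close>, must be
        \<open>e\<close>, which leaves one possible \<open>d\<close>.\<close>
      have det2: "d = d'" if "c = c'" "l \<noteq> d" "l \<noteq> c" "l \<in> face_ix" "l \<noteq> d'" for l
      proof -
        have "l = e" "l = e'" using that(2-5) that(1) perm3_set[OF p] perm3_set[OF p'] by auto
        moreover have "d \<in> {c', d', e'}" using pp(2) perm3_set[OF p'] by simp
        ultimately show ?thesis using that pp by auto
      qed
      show "?X x \<inter> ?X x' = {}"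
      proof (rule ccontr)
        assume "?X x \<inter> ?X x' \<noteq> {}"
        then obtain v l a b where u: "((v, l), a, b) \<in> units"
          "a = 0 \<and> l = d \<and> v d = t \<and> 2 * h \<le> v c \<or> a = c \<and> b = t \<and> l \<noteq> d"
          "a = 0 \<and> l = d' \<and> v d' = t' \<and> 2 * h \<le> v c' \<or> a = c' \<and> b = t' \<and> l \<noteq> d'"
          unfolding x by (fastforce simp: corner_units_def)
        have "0 \<notin> face_ix" by (simp add: face_ix_def)
        then have cc: "c \<noteq> 0" "c' \<noteq> 0" using pp by metis+
        have v: "v \<in> D3 (n - 1)" "l \<in> face_ix" "a \<noteq> 0 \<longrightarrow> l \<noteq> a"
          using u(1) by (auto simp: units_def cut_edges_def)
        show False
        proof (cases "a = 0")
          case True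
          then have "c = c'" "d = d'" "t = t'"
            using u cc two_large[OF v(1), of h c c'] n h pp by auto
          then show False using det ne by simp
        next
          case False
          then have "c = c'" "t = t'" "l \<noteq> d" "l \<noteq> d'" "l \<noteq> c" using u v by auto
          then show False using det det2[OF _ _ _ v(2)] ne by auto
        qed
      qed
    qed
  qed (use finite_lines finX in auto)
  moreover have "card ?O + card (\<Union>l\<in>lines. ?X l) \<le> card units"
  proof -
    have c: "card ?O = card ?o" by (subst card_image) (auto simp: inj_on_def)
    have d: "?o \<inter> (\<Union>l\<in>lines. ?X l) = {}"
    proof -
      have "((v, l), 0, 0) \<notin> corner_units c d t"
        if "\<forall>i\<in>face_ix - {l}. v i < 2 * h" "perm3 c d e" for v l c d e t
      proof -
        have "0 \<notin> face_ix" by (simp add: face_ix_def)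
        then have "c \<noteq> 0" using perm3_mem[OF that(2)] by metis
        then show ?thesis using that(1) perm3_mem[OF that(2)] perm3_neq[OF that(2)]
          by (force simp: corner_units_def)
      qed
      then show ?thesis by auto
    qed
    have e: "finite ?o" "finite (\<Union>l\<in>lines. ?X l)"
      using finite_lines finX finite_subset[of ?O "cut_edges n f"] by auto
    have u: "?o \<union> (\<Union>l\<in>lines. ?X l) \<subseteq> units" by (auto simp: corner_units_def units_def)
    show ?thesis unfolding c card_Un_disjoint[OF e d, symmetric] by (rule card_mono[OF finite_units u])
  qed
  ultimately show ?thesis using card_cut_edges_fill unfolding card_units by linarith
qed

end

section \<open>A side without label 5\<close>

lemma drop_between:
  assumes "g 0" "\<not> g s" obtains r where "r < s" "g r" "\<not> g (Suc r)"
proof -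
  have "\<exists>r<s. g r \<and> \<not> g (Suc r)"
    using assms by (induction s) (auto simp: less_Suc_eq)
  then show thesis using that by blast
qed

context face_labelling
begin

text \<open>Every cell \<open>bump l u\<close> has a corner labelled \<open>5\<close>, so it is not
  monochromatic of colour \<open>l\<close>. Only a \<open>5\<close>-coloured \<open>bump k u\<close>
  could be charged to \<open>u\<close>, and the last assumption excludes it.\<close>

lemma unhitI:
  assumes p: "perm3 i j k" and u: "u \<in> D3 (n - 2)"
    and "f (bump i (bump k u)) = 5" "f (bump i (bump j u)) = 5 \<or> f (bump j (bump k u)) = 5"
    and "\<not> mono_cell face_ix f (bump k u) 5"
  shows "u \<in> missed k"
proof -
  have "5 \<noteq> i" "5 \<noteq> j" "5 \<noteq> k" using perm3_mem[OF p] face_ix(4) by metis+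
  moreover have N: "\<not> mono_cell face_ix f (bump l u) l"
    if "f (bump a (bump l u)) = 5" "a \<in> face_ix" "5 \<noteq> l" for a l
    using that unfolding mono_cell_def by metis
  ultimately have "\<not> mono_cell face_ix f (bump i u) i" "\<not> mono_cell face_ix f (bump j u) j"
    "\<not> mono_cell face_ix f (bump k u) k"
    using assms(3,4) perm3_mem[OF p] by (metis bump_commute)+
  then show ?thesis using u assms(5) unfolding unhit_def perm3_set[OF p] by simp
qed

text \<open>Two coordinates determine a cell. Taking \<open>Suc\<close> for \<open>g\<close> records
  a cell by the line through its \<open>j\<close>-th corner instead of the line through its other
  two corners.\<close>

lemma card_cells_coord_le:
  assumes p: "perm3 i j k" and "finite A1" "finite A2"
    and "\<And>v. v \<in> A \<Longrightarrow> v \<in> D3 m \<and> g (v j) \<in> A1 \<and> v i \<in> A2" "inj g"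
  shows "card A \<le> card A1 * card A2"
proof -
  have "inj_on (\<lambda>v. (g (v j), v i)) A"
  proof (rule inj_onI)
    fix v w assume vw: "v \<in> A" "w \<in> A" "(g (v j), v i) = (g (w j), w i)"
    then have "v j = w j" "v i = w i" using assms(5) by (auto simp: inj_def)
    moreover have "v \<in> D3 m" "w \<in> D3 m" using vw assms(4) by blast+
    ultimately show "v = w" using perm3_lat[OF p] tri_eta[OF p] by (metis add_left_cancel)
  qed
  then have "card A \<le> card (A1 \<times> A2)"
    using assms by (intro card_inj_on_le[of "\<lambda>v. (g (v j), v i)"]) auto
  then show ?thesis by (simp add: card_cartesian_product)
qed

end

section \<open>Uncharged points near cells labelled 5\<close>

context filled_labelling
begin

text \<open>Walk from a \<open>5\<close>-cell along the line with \<open>j\<close>-th coordinate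
  \<open>b\<close>, moving units from \<open>i\<close> to \<open>k\<close>. Where the walk leaves
  the \<open>5\<close>-cells, the point below both the last \<open>5\<close>-cell and the next cell
  is uncharged.\<close>

lemma unhit_on_line:
  assumes p: "perm3 i j k" and abc: "a + b + c = n - 1" and s: "s \<le> a"
    and m: "mono_cell face_ix f (tri i j k a b c) 5"
    and nm: "\<not> mono_cell face_ix f (tri i j k (a - s) b (c + s)) 5"
  shows "\<exists>u\<in>missed k. u j = b"
proof -
  obtain r where r: "r < s" "mono_cell face_ix f (tri i j k (a - r) b (c + r)) 5"
      "\<not> mono_cell face_ix f (tri i j k (a - Suc r) b (c + Suc r)) 5"
    using drop_between[of "\<lambda>r. mono_cell face_ix f (tri i j k (a - r) b (c + r)) 5" s] m nm by auto
  define u where "u = tri i j k (a - Suc r) b (c + r)"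
  have "Suc (a - Suc r) = a - r" using r s by simp
  then have b: "bump i u = tri i j k (a - r) b (c + r)" "bump k u = tri i j k (a - Suc r) b (c + Suc r)"
    by (simp_all add: u_def tri_bump[OF p])
  have "u \<in> missed k"
  proof (rule unhitI[OF p])
    show "u \<in> D3 (n - 2)" using r s abc by (simp add: u_def tri_lat[OF p])
    show "f (bump i (bump k u)) = 5" "f (bump i (bump j u)) = 5 \<or> f (bump j (bump k u)) = 5"
      using r(2) unfolding b(1)[symmetric] mono_cell_perm3[OF p] by (auto simp: bump_commute)
    show "\<not> mono_cell face_ix f (bump k u) 5" using r(3) b by simp
  qed
  then show ?thesis by (rule bexI[rotated]) (simp add: u_def tri_at[OF p])
qed

lemma not_mono5_top:
  assumes "v \<in> D3 (n - 1)" "i \<in> face_ix" "2 * h \<le> v i"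
  shows "\<not> mono_cell face_ix f v 5"
proof -
  have "f (bump i v) = i" using assms bump_D3 by (intro filled) (auto simp: bump_apply)
  then show ?thesis using assms(2) face_ix(4) unfolding mono_cell_def by metis
qed

text \<open>For \<open>v j < h\<close> the walk may go on until the \<open>i\<close>-th coordinate
  is \<open>0\<close>. The \<open>k\<close>-th coordinate is then at least \<open>2 * h\<close>, so
  that cell has a corner labelled \<open>k\<close> and the \<open>5\<close>-cells must have been
  left.\<close>

lemma unhit_low_line:
  assumes p: "perm3 i j k" and v: "v \<in> D3 (n - 1)" "mono_cell face_ix f v 5" "v j < h"
  shows "\<exists>u\<in>missed k. u j = v j"
proof (rule unhit_on_line[OF p, of "v i" "v j" "v k" "v i"])
  have s: "v i + v j + v k = n - 1" using v perm3_lat[OF p] by simp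
  then show "v i + v j + v k = n - 1" .
  show "mono_cell face_ix f (tri i j k (v i) (v j) (v k)) 5" using v tri_eta[OF p] by simp
  have "2 * h \<le> v k + v i" using s v(3) n by linarith
  then show "\<not> mono_cell face_ix f (tri i j k (v i - v i) (v j) (v k + v i)) 5"
    using s perm3_mem[OF p] by (intro not_mono5_top[of _ k]) (auto simp: tri_lat[OF p] tri_at[OF p])
qed simp

text \<open>If no uncharged point shares the \<open>i\<close>-th coordinate of \<open>v\<close>,
  moving units from \<open>j\<close> to \<open>k\<close> stays within \<open>5\<close>-cells. When
  \<open>v j \<ge> h\<close>, this reaches every \<open>j\<close>-th coordinate below
  \<open>h\<close>, and \<open>unhit_low_line\<close> gives an uncharged point for each.\<close>

lemma unhit_mono5:
  assumes p: "perm3 i j k" and v: "v \<in> D3 (n - 1)" "mono_cell face_ix f v 5"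
  shows "(\<exists>u\<in>missed k. u j = v j) \<or> (\<exists>u\<in>missed k. u i = v i) \<or> h \<le> card (missed k)"
proof (rule ccontr)
  assume "\<not> ?thesis"
  then have no: "\<not> (\<exists>u\<in>missed k. u j = v j)" "\<not> (\<exists>u\<in>missed k. u i = v i)" "card (missed k) < h" by auto
  note p' = perm3_swap[OF p]
  have s: "v i + v j + v k = n - 1" using v perm3_lat[OF p] by simp
  have m: "mono_cell face_ix f (tri i j k (v i) (v j - r) (v k + r)) 5" if "r \<le> v j" for r
  proof (rule ccontr)
    assume "\<not> ?thesis"
    then show False using unhit_on_line[OF p', of "v j" "v i" "v k" r] that s no(2) v
      by (simp add: tri_swap12[OF p] tri_eta[OF p] add.commute)
  qed
  have "h \<le> v j" using unhit_low_line[OF p v] no(1) by force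
  have "t \<in> (\<lambda>u. u j) ` missed k" if t: "t < h" for t
  proof -
    let ?w = "tri i j k (v i) t (v k + (v j - t))"
    have "mono_cell face_ix f ?w 5" using m[of "v j - t"] t \<open>h \<le> v j\<close> by simp
    then have "\<exists>u\<in>missed k. u j = ?w j" using unhit_low_line[OF p, of ?w] s t \<open>h \<le> v j\<close>
      by (simp add: tri_at[OF p] tri_lat[OF p])
    then show ?thesis by (auto simp: tri_at[OF p])
  qed
  then have "card {..<h} \<le> card ((\<lambda>u. u j) ` missed k)"
    by (intro card_mono) (auto simp: unhit_def intro: finite_subset[OF _ finite_lat])
  also have "\<dots> \<le> card (missed k)" by (intro card_image_le) (simp add: unhit_def)
  finally show False using no(3) by simp
qed

end

section \<open>Cells labelled 5 before repainting\<close>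

context face_labelling
begin

abbreviation fmissed where "fmissed k \<equiv> unhit face_ix k 5 (fill h f) (n - 2)"

lemma slack_or_5:
  assumes p: "perm3 c d e" and x: "x \<in> D3 n" "f x = 5" "2 * h < x c"
  shows "slack c d e (x d) \<or> f (tri c d e (2 * h) (x d) (h - x d)) = 5"
proof -
  have s: "x c + x d + x e = n" using x perm3_lat[OF p] by simp
  let ?s = "x c - 2 * h"
  have "x d < h" "0 < ?s" "?s \<le> h - x d" "2 * h + ?s = x c" "h - x d - ?s = x e"
    using s x(3) n by linarith+
  then show ?thesis using x tri_eta[OF p] unfolding slack_def by metis
qed

text \<open>A \<open>5\<close> inside \<open>T_c\<close> makes its line slack unless the line also
  has a \<open>5\<close> at \<open>x c = 2 * h\<close>. The corners \<open>bump c v\<close> and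
  \<open>bump d v\<close> thus yield two adjacent \<open>5\<close>s on that row, where
  \<open>fill\<close> changes nothing.\<close>

lemma mono5_in_corner:
  assumes p: "perm3 c d e" and v: "v \<in> D3 (n - 1)" "mono_cell face_ix f v 5" "2 * h \<le> v c"
    and ns: "\<not> slack c d e (v d)" "\<not> slack c d e (Suc (v d))"
  shows "f (tri c d e (2 * h) (v d) (h - v d)) = 5"
    "f (tri c d e (2 * h) (Suc (v d)) (h - Suc (v d))) = 5" "v d < h"
proof -
  have s: "v c + v d + v e = n - 1" using v perm3_lat[OF p] by simp
  have m: "f (bump c v) = 5" "f (bump d v) = 5" using v mono_cell_perm3[OF p] by auto
  have D: "bump c v \<in> D3 n" "bump d v \<in> D3 n" using v bump_D3 perm3_mem[OF p] by auto
  show "v d < h" using s v(3) n h by linarith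
  show "f (tri c d e (2 * h) (v d) (h - v d)) = 5"
    using slack_or_5[OF p D(1) m(1)] ns(1) v(3) perm3_neq[OF p] by (simp add: bump_apply)
  show "f (tri c d e (2 * h) (Suc (v d)) (h - Suc (v d))) = 5"
  proof (cases "v c = 2 * h")
    case True
    then have "h - Suc (v d) = v e" using s n by simp
    then have "tri c d e (2 * h) (Suc (v d)) (h - Suc (v d)) = bump d v"
      using True tri_eta[OF p v(1)] tri_bump(2)[OF p] by metis
    then show ?thesis using m by simp
  next
    case False
    then show ?thesis
      using slack_or_5[OF p D(2) m(2)] ns(2) v(3) perm3_neq[OF p] by (simp add: bump_apply)
  qed
qed

lemma fill_row:
  assumes p: "perm3 c d e" and "t \<le> h"
  shows "fill h f (tri c d e (2 * h) t (h - t)) = f (tri c d e (2 * h) t (h - t))"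
  using assms(2) by (intro fill_else) (auto simp: perm3_set[OF p] tri_at[OF p])

text \<open>The two \<open>5\<close>s on the row \<open>x i = 2 * h\<close> survive the repainting.
  The point \<open>u\<close> below both is uncharged unless \<open>bump k u\<close> is a
  \<open>5\<close>-cell; that cell has \<open>j\<close>-th coordinate below \<open>h\<close>, so
  \<open>unhit_low_line\<close> finds an uncharged point on its line.\<close>

lemma unhit_corner:
  assumes p: "perm3 i j k" and v: "v \<in> D3 (n - 1)" "mono_cell face_ix f v 5" "2 * h \<le> v i"
    and ns: "\<not> slack i j k (v j)" "\<not> slack i j k (Suc (v j))"
  shows "\<exists>u\<in>fmissed k. u j = v j"
proof -
  interpret F: filled_labelling h n "fill h f" by (rule filled_labelling_fill)
  note y = mono5_in_corner[OF p v ns]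
  define u where "u = tri i j k (2 * h - 1) (v j) (h - Suc (v j))"
  have uD: "u \<in> D3 (n - 2)" using y(3) n h by (simp add: u_def tri_lat[OF p])
  have e: "Suc (2 * h - 1) = 2 * h" "Suc (h - Suc (v j)) = h - v j" using y(3) h by auto
  have 5: "fill h f (bump i (bump k u)) = 5" "fill h f (bump i (bump j u)) = 5"
    using y fill_row[OF p] by (auto simp: u_def tri_bump[OF p] e)
  show ?thesis
  proof (cases "mono_cell face_ix (fill h f) (bump k u) 5")
    case True
    have "bump k u \<in> D3 (n - 1)" "bump k u j = v j"
      using y(3) n h by (auto simp: u_def tri_lat[OF p] tri_at[OF p] tri_bump[OF p])
    then show ?thesis using F.unhit_low_line[OF p _ True] y(3) by simp
  next
    case False
    then have "u \<in> fmissed k" using F.unhitI[OF p uD] 5 by blast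
    then show ?thesis by (rule bexI[rotated]) (simp add: u_def tri_at[OF p])
  qed
qed

text \<open>Near the corner \<open>k\<close> the cell \<open>bump k u\<close> reaches into the
  filled region, so it is not a \<open>5\<close>-cell and \<open>u\<close> itself is
  uncharged.\<close>

lemma unhit_top:
  assumes p: "perm3 i j k" and v: "v \<in> D3 (n - 1)" "mono_cell face_ix f v 5" "2 * h \<le> v k"
    and ns: "\<not> slack k j i (v j)" "\<not> slack k j i (Suc (v j))"
  shows "\<exists>u\<in>fmissed k. u j = v j"
proof -
  interpret F: filled_labelling h n "fill h f" by (rule filled_labelling_fill)
  have p': "perm3 k j i" using p by (auto simp: perm3_def)
  note y = mono5_in_corner[OF p' v ns]
  define u where "u = tri k j i (2 * h - 1) (v j) (h - Suc (v j))"
  have uD: "u \<in> D3 (n - 2)" using y(3) n h by (simp add: u_def tri_lat[OF p'])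
  have e: "Suc (2 * h - 1) = 2 * h" "Suc (h - Suc (v j)) = h - v j" using y(3) h by auto
  have 5: "fill h f (bump i (bump k u)) = 5" "fill h f (bump j (bump k u)) = 5"
    using y fill_row[OF p'] by (auto simp: u_def tri_bump[OF p'] e)
  have "bump k u \<in> D3 (n - 1)" "2 * h \<le> bump k u k"
    using y(3) n h by (auto simp: u_def tri_lat[OF p'] tri_at[OF p'] tri_bump[OF p'])
  then have "\<not> mono_cell face_ix (fill h f) (bump k u) 5"
    using F.not_mono5_top perm3_mem[OF p] by blast
  then have "u \<in> fmissed k" using F.unhitI[OF p uD] 5 by blast
  then show ?thesis by (rule bexI[rotated]) (simp add: u_def tri_at[OF p'])
qed

lemma mono5_cases:
  assumes p: "perm3 i j k" and v: "v \<in> D3 (n - 1)" "mono_cell face_ix f v 5" and few: "card (fmissed k) < h"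
  shows "(\<exists>u\<in>fmissed k. u j = v j) \<or> (\<exists>u\<in>fmissed k. u i = v i)
    \<or> (\<exists>(c, d, e) \<in> {(i, j, k), (j, i, k), (k, j, i)}. 2 * h \<le> v c
          \<and> (slack c d e (v d) \<or> slack c d e (Suc (v d))))"
proof (cases "\<exists>c\<in>face_ix. 2 * h \<le> v c")
  case True
  then consider "2 * h \<le> v i" | "2 * h \<le> v j" | "2 * h \<le> v k" by (auto simp: perm3_set[OF p])
  then show ?thesis
    using unhit_corner[OF p v] unhit_corner[OF perm3_swap[OF p] v] unhit_top[OF p v]
    by cases auto
next
  case False
  interpret F: filled_labelling h n "fill h f" by (rule filled_labelling_fill)
  have "fill h f (bump l v) = f (bump l v)" if "l \<in> face_ix" for l
    using False by (intro fill_else) (auto simp: bump_apply not_le Suc_le_eq less_imp_le)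
  then have "mono_cell face_ix (fill h f) v 5" using v(2) by (simp add: mono_cell_def)
  then show ?thesis using F.unhit_mono5[OF p v(1)] few by auto
qed

text \<open>An uncharged point accounts for two lines of at most \<open>n\<close> cells each; a
  slack line of \<open>T_c\<close> for at most \<open>h\<close> cells with \<open>v d = t\<close>
  and at most \<open>h\<close> cells with \<open>v d + 1 = t\<close>.\<close>

lemma card_mono5_le:
  assumes p: "perm3 i j k" and few: "card (fmissed k) < h"
  shows "card {v \<in> D3 (n - 1). mono_cell face_ix f v 5}
    \<le> 2 * n * card (fmissed k) + 2 * h * card {(c, d, e, t) \<in> lines. slack c d e t}"
proof -
  let ?SL = "{(c, d, e, t) \<in> lines. slack c d e t}"
  let ?T = "\<lambda>(c, d, e). {t. slack c d e t}"
  let ?P = "{(i, j, k), (j, i, k), (k, j, i)}"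
  let ?A = "\<lambda>l. {v \<in> D3 (n - 1). \<exists>u\<in>fmissed k. u l = v l}"
  let ?S = "\<lambda>(c, d, e). {v \<in> D3 (n - 1). 2 * h \<le> v c \<and> slack c d e (v d)}"
  let ?S' = "\<lambda>(c, d, e). {v \<in> D3 (n - 1). 2 * h \<le> v c \<and> slack c d e (Suc (v d))}"
  have P: "perm3 c d e" if "(c, d, e) \<in> ?P" for c d e using p that by (auto simp: perm3_def)
  note neq = perm3_neq[OF p]
  have finU: "finite (fmissed k)" by (simp add: unhit_def)
  have le: "v c < n" if "v \<in> D3 (n - 1)" "perm3 c d e" for v c d e
  proof -
    have "v c + v d + v e = n - 1" using that perm3_lat by simp
    then show ?thesis using n h by linarith
  qed
  have A: "card {v \<in> D3 (n - 1). \<exists>u\<in>fmissed k. u d = v d} \<le> card (fmissed k) * n" if q: "perm3 c d e" for c d e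
  proof -
    have "card {v \<in> D3 (n - 1). \<exists>u\<in>fmissed k. u d = v d} \<le> card ((\<lambda>u. u d) ` fmissed k) * card {..<n}"
    proof (rule card_cells_coord_le[OF q, of _ _ _ "n - 1" id])
      fix v assume v: "v \<in> {v \<in> D3 (n - 1). \<exists>u\<in>fmissed k. u d = v d}"
      then show "v \<in> D3 (n - 1) \<and> id (v d) \<in> (\<lambda>u. u d) ` fmissed k \<and> v c \<in> {..<n}"
        using le[OF _ q, of v] by (auto simp flip: id_def intro: rev_image_eqI)
    qed (use finU in auto)
    also have "\<dots> \<le> card (fmissed k) * n" using card_image_le[OF finU, of "\<lambda>u. u d"] by simp
    finally show ?thesis .
  qed
  have finT: "finite {t. slack c d e t}" for c d e
    by (rule finite_subset[of _ "{..<h}"]) (auto simp: slack_def)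
  have S: "card (?S x) \<le> card (?T x) * h" "card (?S' x) \<le> card (?T x) * h" if "x \<in> ?P" for x
  proof -
    obtain c d e where x: "x = (c, d, e)" by (cases x)
    then have q: "perm3 c d e" using that P by blast
    have "card (?S x) \<le> card {t. slack c d e t} * card {2 * h..<n}" unfolding x prod.case
      by (rule card_cells_coord_le[OF q finT, of _ _ "n - 1" id]) (use le[OF _ q] in auto)
    then show "card (?S x) \<le> card (?T x) * h" using n by (simp add: x)
    have "card (?S' x) \<le> card {t. slack c d e t} * card {2 * h..<n}" unfolding x prod.case
      by (rule card_cells_coord_le[OF q finT, of _ _ "n - 1" Suc]) (use le[OF _ q] in auto)
    then show "card (?S' x) \<le> card (?T x) * h" using n by (simp add: x)
  qed
  have finS: "finite (?A l)" "finite (?S x)" "finite (?S' x)" for l x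
    by (auto simp: case_prod_unfold)
  have "{v \<in> D3 (n - 1). mono_cell face_ix f v 5} \<subseteq> ?A j \<union> ?A i \<union> (\<Union>x\<in>?P. ?S x \<union> ?S' x)"
    using mono5_cases[OF p _ _ few] by fastforce
  then have "card {v \<in> D3 (n - 1). mono_cell face_ix f v 5}
      \<le> card (?A j \<union> ?A i \<union> (\<Union>x\<in>?P. ?S x \<union> ?S' x))"
    using finS by (intro card_mono) auto
  also have "\<dots> \<le> card (?A j) + card (?A i) + card (\<Union>x\<in>?P. ?S x \<union> ?S' x)"
    by (meson add_le_mono1 card_Un_le order_trans)
  also have "card (\<Union>x\<in>?P. ?S x \<union> ?S' x) \<le> (\<Sum>x\<in>?P. card (?S x \<union> ?S' x))"
    by (rule card_UN_le) simp
  also have "\<dots> \<le> (\<Sum>x\<in>?P. 2 * h * card (?T x))"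
  proof (rule sum_mono)
    fix x assume "x \<in> ?P"
    then show "card (?S x \<union> ?S' x) \<le> 2 * h * card (?T x)"
      using S[of x] card_Un_le[of "?S x" "?S' x"] by (simp add: mult.commute)
  qed
  also have "\<dots> = 2 * h * (\<Sum>x\<in>?P. card (?T x))" by (simp add: sum_distrib_left)
  also have "(\<Sum>x\<in>?P. card (?T x)) \<le> card ?SL"
  proof -
    have "(\<Sum>x\<in>?P. card (?T x)) = card (SIGMA x : ?P. ?T x)"
      using finT by (subst card_SigmaI) auto
    also have "\<dots> \<le> card ?SL"
    proof (rule card_inj_on_le[of "\<lambda>((c, d, e), t). (c, d, e, t)"])
      show "(\<lambda>((c, d, e), t). (c, d, e, t)) ` (SIGMA x : ?P. ?T x) \<subseteq> ?SL"
      proof (rule image_subsetI)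
        fix x assume x: "x \<in> (SIGMA x : ?P. ?T x)"
        obtain c d e t where cdet: "x = ((c, d, e), t)" by (metis surj_pair)
        then have "perm3 c d e" "slack c d e t" using x P[of c d e] by auto
        then show "(\<lambda>((c, d, e), t). (c, d, e, t)) x \<in> ?SL" using cdet by (simp add: slack_def)
      qed
      show "finite ?SL" by (rule finite_subset[OF _ finite_lines]) auto
      have "inj (\<lambda>((c :: nat, d :: nat, e :: nat), t :: nat). (c, d, e, t))" by (auto simp: inj_def)
      then show "inj_on (\<lambda>((c, d, e), t). (c, d, e, t)) (SIGMA x : ?P. ?T x)"
        by (rule inj_on_subset) simp
    qed
    finally show ?thesis .
  qed
  also have "card (?A j) + card (?A i) \<le> 2 * n * card (fmissed k)"
    using A[OF p] A[OF perm3_swap[OF p]] by (simp add: algebra_simps)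
  finally show ?thesis by simp
qed

text \<open>Repainting puts no \<open>5\<close> on the side \<open>k\<close>, so each uncharged
  point is worth two cut edges and each slack line one unit. Multiplied by \<open>n\<close> this
  covers the count of \<open>card_mono5_le\<close>, as \<open>2 * h \<le> n\<close>; with at least
  \<open>h\<close> uncharged points the first alternative holds.\<close>

lemma weight_ge_no5:
  assumes k: "k \<in> face_ix" and no5: "\<And>x. x \<in> D3 n \<Longrightarrow> x k = 0 \<Longrightarrow> f x \<noteq> 5"
  defines "W \<equiv> \<Sum>(v, k)\<in>cut_edges n f. wt h v k"
  shows "2 * n + 2 * h \<le> W
    \<or> 2 * n * n + card {v \<in> D3 (n - 1). mono_cell face_ix f v 5} \<le> n * W"
proof -
  interpret F: filled_labelling h n "fill h f" by (rule filled_labelling_fill)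
  obtain i j where p: "perm3 i j k" using perm3_extend k .
  let ?SL = "{(c, d, e, t) \<in> lines. slack c d e t}"
  have "fill h f x \<noteq> 5" if "x \<in> D3 n" "x k = 0" for x
    by (rule fill_cases[of x]) (use that fill_top[of x] no5 in force)+
  then have W: "2 * (n + card (fmissed k)) + card ?SL \<le> W"
    using F.card_cut_edges_no5[OF k] weight_ge_fill unfolding W_def by fastforce
  show ?thesis
  proof (cases "card (fmissed k) < h")
    case True
    have "2 * h * card ?SL \<le> n * card ?SL" by (rule mult_right_mono) (use n in auto)
    then have "2 * n * n + card {v \<in> D3 (n - 1). mono_cell face_ix f v 5}
        \<le> 2 * n * n + 2 * n * card (fmissed k) + n * card ?SL"
      using card_mono5_le[OF p True] by linarith
    also have "\<dots> = n * (2 * (n + card (fmissed k)) + card ?SL)" by (simp add: algebra_simps)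
    also have "\<dots> \<le> n * W" using W by simp
    finally show ?thesis by simp
  next
    case False
    then show ?thesis using W by simp
  qed
qed

end

section \<open>Red triangles and tetrahedra\<close>

lemma card_corner_cells:
  assumes "k \<in> face_ix" "m \<le> n"
  shows "m * m \<le> 2 * card {v \<in> D3 (n - 1). n - m \<le> v k}"
proof -
  obtain i j where p: "perm3 i j k" using perm3_extend assms(1) .
  let ?g = "\<lambda>(a, b). tri i j k a b (n - 1 - a - b)"
  have "m * m \<le> 2 * (\<Sum>a<m. m - a)"
  proof (induction m)
    case (Suc m)
    then show ?case by (simp add: sum.lessThan_Suc_shift del: sum.lessThan_Suc)
  qed simp
  also have "(\<Sum>a<m. m - a) = card (SIGMA a : {..<m}. {..<m - a})" by simp
  also have "\<dots> \<le> card {v \<in> D3 (n - 1). n - m \<le> v k}"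
  proof (rule card_inj_on_le[of ?g])
    show "inj_on ?g (SIGMA a : {..<m}. {..<m - a})" by (auto simp: inj_on_def tri_inject[OF p])
    show "?g ` (SIGMA a : {..<m}. {..<m - a}) \<subseteq> {v \<in> D3 (n - 1). n - m \<le> v k}"
      using assms(2) by (auto simp: tri_lat[OF p] tri_at[OF p])
  qed simp
  finally show ?thesis by simp
qed

text \<open>With \<open>c = m / n\<close>, these are the points of \<open>R_k\<close> and the edges of \<open>Gamma_k\<close>.\<close>

definition ring :: "nat \<Rightarrow> nat \<Rightarrow> nat \<Rightarrow> (nat \<Rightarrow> nat) set" where
  "ring n m k = {x \<in> D3 n. n - m \<le> x k \<and> (x k = n - m \<or> (\<exists>i\<in>face_ix - {k}. x i = 0))}"

definition ring_edge :: "nat \<Rightarrow> nat \<Rightarrow> nat \<Rightarrow> (nat \<Rightarrow> nat) \<times> nat \<Rightarrow> bool" where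
  "ring_edge n m k = (\<lambda>(v, l). n - m \<le> v k \<and> (if l = k then v k = n - m else v l = 0))"

context face_labelling
begin

text \<open>Multiplied by \<open>rho n\<close> this is the constant \<open>6 / 5\<close>.\<close>

lemma weight_ge: "2 * n \<le> (\<Sum>(v, k)\<in>cut_edges n f. wt h v k)"
proof -
  interpret F: filled_labelling h n "fill h f" by (rule filled_labelling_fill)
  show ?thesis using F.card_cut_edges_filled weight_ge_fill by linarith
qed

lemma side_cut:
  assumes "k \<in> face_ix"
  shows "1 \<le> card {(v, l) \<in> cut_edges n f. l = k \<and> v k = 0}"
proof -
  obtain i j where p: "perm3 i j k" using perm3_extend assms .
  have "f (tri i j k n 0 0) = i" "f (tri i j k 0 n 0) = j"
    using corner[OF p] corner[OF perm3_swap[OF p]] tri_swap12[OF p, of n 0 0] by auto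
  then obtain s where s: "(tri i j k (n - s - 1) s 0, k) \<in> cut_edges n f"
    using line_cut[OF p, of 0 n 0 n f] perm3_neq[OF p] by auto
  have "finite {(v, l) \<in> cut_edges n f. l = k \<and> v k = 0}"
    by (rule finite_subset[OF _ finite_cut_edges]) auto
  then show ?thesis using s tri_at[OF p] by (fastforce simp: Suc_le_eq card_gt_0_iff)
qed

lemma side_two_cuts:
  assumes "k \<in> face_ix" "x \<in> D3 n" "x k = 0" "f x = 5"
  shows "2 \<le> card {(v, l) \<in> cut_edges n f. l = k \<and> v k = 0}"
proof -
  obtain i j where p: "perm3 i j k" using perm3_extend assms(1) .
  have "f (tri i j k n 0 0) = i" "f (tri i j k 0 n 0) = j"
    using corner[OF p] corner[OF perm3_swap[OF p]] tri_swap12[OF p, of n 0 0] by auto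
  then show ?thesis using line_two_cuts[where f = f, OF p assms(2,4,3)] by simp
qed

text \<open>The ring is a closed walk through the corner labelled \<open>k\<close>; a point of
  another label forces a change on either way around.\<close>

lemma ring_two_cuts:
  assumes k: "k \<in> face_ix" and m: "m \<le> n" and x: "x \<in> ring n m k" "f x \<noteq> k"
  shows "2 \<le> card {e \<in> cut_edges n f. ring_edge n m k e}"
proof -
  define Q where "Q = {e \<in> cut_edges n f. ring_edge n m k e}"
  have fin: "finite Q" by (simp add: Q_def)
  obtain a b where p: "perm3 k a b"
    using perm3_extend[OF k] perm3_rotate by metis
  have p': "perm3 k b a" "perm3 a b k" using p by (auto simp: perm3_def)
  note pp = perm3_mem[OF p] perm3_neq[OF p]
  \<comment> \<open>The closed walk in three segments: \<open>A\<close> and \<open>B\<close> run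
    from the corner \<open>k\<close> down the two sides, \<open>C\<close> runs along the base from
    the end of \<open>A\<close> to the end of \<open>B\<close>.\<close>
  define A where "A s = f (tri k a b (n - s) s 0)" for s
  define B where "B s = f (tri k b a (n - s) s 0)" for s
  define C where "C s = f (tri a b k (m - s) s (n - m))" for s
  define eA where "eA s = (tri k a b (n - s - 1) s 0, b)" for s
  define eB where "eB s = (tri k b a (n - s - 1) s 0, a)" for s
  define eC where "eC s = (tri a b k (m - s - 1) s (n - m), k)" for s
  have cA: "\<exists>r\<ge>s. r < s' \<and> eA r \<in> Q" if "s \<le> s'" "s' \<le> m" "A s \<noteq> A s'" for s s'
  proof -
    note st = that
    have "s' + 0 \<le> n" using that m by simp
    then obtain r where "s \<le> r" "r < s'" "(tri k a b (n - 0 - r - 1) r 0, b) \<in> cut_edges n f"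
      using line_cut[OF p, of s s' 0 n f] st(1,3) by (auto simp: A_def)
    then show ?thesis using that m pp
      by (intro exI[of _ r]) (auto simp: Q_def eA_def ring_edge_def tri_at[OF p])
  qed
  have cB: "\<exists>r\<ge>s. r < s' \<and> eB r \<in> Q" if "s \<le> s'" "s' \<le> m" "B s \<noteq> B s'" for s s'
  proof -
    note st = that
    have "s' + 0 \<le> n" using that m by simp
    then obtain r where "s \<le> r" "r < s'" "(tri k b a (n - 0 - r - 1) r 0, a) \<in> cut_edges n f"
      using line_cut[OF p'(1), of s s' 0 n f] st(1,3) by (auto simp: B_def)
    then show ?thesis using that m pp
      by (intro exI[of _ r]) (auto simp: Q_def eB_def ring_edge_def tri_at[OF p'(1)])
  qed
  have cC: "\<exists>r\<ge>s. r < s' \<and> eC r \<in> Q" if "s \<le> s'" "s' \<le> m" "C s \<noteq> C s'" for s s'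
  proof -
    note st = that
    have e: "n - (n - m) - s = m - s" for s using m by simp
    have sm: "s' + (n - m) \<le> n" using st m by simp
    have ne: "f (tri a b k (n - (n - m) - s) s (n - m)) \<noteq> f (tri a b k (n - (n - m) - s') s' (n - m))"
      using st(3) unfolding C_def e .
    obtain r where r: "s \<le> r" "r < s'" "(tri a b k (n - (n - m) - r - 1) r (n - m), k) \<in> cut_edges n f"
      using line_cut[OF p'(2) st(1) sm ne] .
    then show ?thesis unfolding e using st m pp
      by (intro exI[of _ r]) (simp add: Q_def eC_def ring_edge_def tri_at[OF p'(2)])
  qed
  have ends: "A 0 = k" "B 0 = k" using corner p p'(1) by (auto simp: A_def B_def)
  have AC: "A m = C 0"
    unfolding A_def C_def using tri_swap12[OF p] tri_swap23[OF perm3_swap[OF p]] by simp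
  have BC: "B m = C m"
    unfolding B_def C_def using tri_swap23[OF p] tri_swap12[OF p] tri_swap23[OF perm3_swap[OF p]]
    by (metis diff_self_eq_0 p perm3_rotate perm3_swap tri_swap12 tri_swap13 tri_swap23)
  have two: ?thesis if "e \<in> Q" "e' \<in> Q" "e \<noteq> e'" for e e'
    using that card_mono[OF fin, of "{e, e'}"] by (simp add: Q_def)
  have inj: "eA s = eA s' \<longleftrightarrow> s = s'" "eB s = eB s' \<longleftrightarrow> s = s'" "eC s = eC s' \<longleftrightarrow> s = s'"
    "eA s \<noteq> eB s'" "eA s \<noteq> eC s'" "eB s \<noteq> eC s'" for s s'
    using pp by (auto simp: eA_def eB_def eC_def tri_inject[OF p] tri_inject[OF p'(1)] tri_inject[OF p'(2)])
  show ?thesis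
  proof (cases "A m = k \<and> B m = k")
    case False
    \<comment> \<open>If an end of the base is not labelled \<open>k\<close>, at least two of the
      three segments have differently labelled ends.\<close>
    have a: "\<exists>r. eA r \<in> Q" if "A m \<noteq> k" using cA[OF le0 order_refl] ends(1) that by metis
    have b: "\<exists>r. eB r \<in> Q" if "B m \<noteq> k" using cB[OF le0 order_refl] ends(2) that by metis
    have c: "\<exists>r. eC r \<in> Q" if "A m \<noteq> B m"
    proof -
      have "C 0 \<noteq> C m" using that unfolding AC BC .
      then show ?thesis using cC[OF le0 order_refl] by blast
    qed
    consider "A m \<noteq> k" "B m \<noteq> k" | "A m \<noteq> k" "B m = k" | "A m = k" "B m \<noteq> k" using False by blast
    then show ?thesis
    proof cases
      case 1
      then obtain r r' where "eA r \<in> Q" "eB r' \<in> Q" using a b by blast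
      then show ?thesis using two inj(4) by blast
    next
      case 2
      then obtain r r' where "eA r \<in> Q" "eC r' \<in> Q" using a c by metis
      then show ?thesis using two inj(5) by blast
    next
      case 3
      then obtain r r' where "eB r \<in> Q" "eC r' \<in> Q" using b c by metis
      then show ?thesis using two inj(6) by blast
    qed
  next
    case True
    \<comment> \<open>Now all three segments begin and end with \<open>k\<close>, so the one with
      the wrong label contains both changes.\<close>
    have "\<exists>s\<le>m. A s \<noteq> k \<or> B s \<noteq> k \<or> C s \<noteq> k"
    proof -
      have x3: "x \<in> D3 n" "n - m \<le> x k" using x by (auto simp: ring_def)
      have s: "x k + x a + x b = n" using x3 perm3_lat[OF p] by simp
      consider "x b = 0" | "x a = 0" | "x k = n - m"
        using x perm3_set[OF p] by (auto simp: ring_def)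
      then show ?thesis
      proof cases
        case 1
        then have "n - x a = x k" "x a \<le> m" using s x3 by simp_all
        then have "A (x a) = f x" using 1 tri_eta[OF p x3(1)] by (simp add: A_def)
        then show ?thesis using x(2) \<open>x a \<le> m\<close> by metis
      next
        case 2
        then have "n - x b = x k" "x b \<le> m" using s x3 by simp_all
        then have "B (x b) = f x" using 2 tri_eta[OF p'(1) x3(1)] by (simp add: B_def)
        then show ?thesis using x(2) \<open>x b \<le> m\<close> by metis
      next
        case 3
        then have "m - x b = x a" "x b \<le> m" using s x3 m by simp_all
        then have "C (x b) = f x" using 3 tri_eta[OF p'(2) x3(1)] by (simp add: C_def)
        then show ?thesis using x(2) \<open>x b \<le> m\<close> by metis
      qed
    qed
    then obtain s where s: "s \<le> m" "A s \<noteq> k \<or> B s \<noteq> k \<or> C s \<noteq> k" by blast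
    from s(2) consider "A s \<noteq> k" | "B s \<noteq> k" | "C s \<noteq> k" by blast
    then show ?thesis
    proof cases
      case 1
      then obtain r r' where "r < s" "eA r \<in> Q" "s \<le> r'" "eA r' \<in> Q"
        using cA[OF le0 s(1)] cA[OF s(1) order_refl] ends(1) True by metis
      then show ?thesis using two inj(1) by (metis not_le)
    next
      case 2
      then obtain r r' where "r < s" "eB r \<in> Q" "s \<le> r'" "eB r' \<in> Q"
        using cB[OF le0 s(1)] cB[OF s(1) order_refl] ends(2) True by metis
      then show ?thesis using two inj(2) by (metis not_le)
    next
      case 3
      then obtain r r' where "r < s" "eC r \<in> Q" "s \<le> r'" "eC r' \<in> Q"
        using cC[OF le0 s(1)] cC[OF s(1) order_refl] AC BC True by metis
      then show ?thesis using two inj(3) by (metis not_le)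
    qed
  qed
qed

text \<open>Repainting the corner triangles of \<open>K\<close> cuts no new edge, because their
  boundaries already carry the right label, and the result still weighs at least
  \<open>2 * n\<close>. The cut edges lost in a triangle, counted in one direction only, pay for its
  \<open>5\<close>-cells.\<close>

lemma weight_ge_rings:
  assumes K: "K \<subseteq> face_ix" and m: "2 * m < n" and ring: "\<And>k x. k \<in> K \<Longrightarrow> x \<in> ring n m k \<Longrightarrow> f x = k"
  shows "2 * n * n + (\<Sum>k\<in>K. card {v \<in> D3 (n - 1). n - m \<le> v k \<and> mono_cell face_ix f v 5})
    \<le> n * (\<Sum>(v, k)\<in>cut_edges n f. wt h v k)"
proof -
  define g where "g x = (if \<exists>k\<in>K. n - m \<le> x k then (SOME k. k \<in> K \<and> n - m \<le> x k) else f x)" for x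
  have uniq: "k = l" if kl: "x \<in> D3 d" "d \<le> n" "k \<in> face_ix" "l \<in> face_ix" "n - m \<le> x k" "n - m \<le> x l" for x k l d
  proof (rule ccontr)
    assume "k \<noteq> l"
    then obtain j where p: "perm3 k j l" using perm3_extend2 kl(3,4) by metis
    have "x k + x j + x l = d" using that perm3_lat[OF p] by simp
    then show False using that m by linarith
  qed
  have g_in: "g x = k" if "x \<in> D3 n" "k \<in> K" "n - m \<le> x k" for x k
  proof -
    have "(SOME k. k \<in> K \<and> n - m \<le> x k) = k"
      by (rule some_equality) (use that uniq[OF that(1)] K in blast)+
    then show ?thesis using that by (auto simp: g_def)
  qed
  have g_out: "g x = f x" if "\<And>k. k \<in> K \<Longrightarrow> x k < n - m" for x
    using that unfolding g_def by (meson not_le)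
  have g_eq: "g x = f x \<or> (\<exists>k\<in>K. n - m < x k \<and> g x = k)" if x: "x \<in> D3 n" for x
  proof (cases "\<exists>k\<in>K. n - m \<le> x k")
    case True
    then obtain k where k: "k \<in> K" "n - m \<le> x k" by blast
    then have "x k = n - m \<Longrightarrow> f x = k" using ring x by (auto simp: ring_def)
    then show ?thesis using k g_in[OF x] by (metis le_neq_implies_less)
  qed (use g_out in \<open>force simp: not_le\<close>)
  interpret g: face_labelling h n g
  proof
    show "g x \<in> insert 5 face_ix" if "x \<in> D3 n" for x
      using g_eq[OF that] range[OF that] K by auto
    show "0 < x (g x)" if "x \<in> D3 n" "g x \<noteq> 5" for x
      using g_eq[OF that(1)] support[OF that(1)] that(2) by auto
    show "g (tri i j k n 0 0) = i" if p: "perm3 i j k" for i j k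
    proof -
      have "tri i j k n 0 0 \<in> D3 n" using tri_lat[OF p] by simp
      then consider "g (tri i j k n 0 0) = f (tri i j k n 0 0)"
        | l where "l \<in> K" "n - m < tri i j k n 0 0 l" "g (tri i j k n 0 0) = l"
        using g_eq by blast
      then show ?thesis
      proof cases
        case 2
        then have "l \<in> {i, j, k}" using K perm3_set[OF p] by blast
        then have "l = i" using 2(2) tri_at[OF p] by auto
        then show ?thesis using 2(3) by simp
      qed (use corner[OF p] in simp)
    qed
  qed (use n h in auto)
  have cut: "(v, l) \<in> cut_edges n f \<and> \<not> (\<exists>k\<in>K. l \<noteq> k \<and> n - m \<le> v k)" if vl: "(v, l) \<in> cut_edges n g" for v l
  proof -
    obtain i j where p: "perm3 i j l" using vl perm3_extend unfolding cut_edges_def by blast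
    note pp = perm3_mem[OF p] perm3_neq[OF p]
    have v: "v \<in> D3 (n - 1)" "g (bump i v) \<noteq> g (bump j v)" using vl cut_edges_iff[OF p] by auto
    have D: "bump i v \<in> D3 n" "bump j v \<in> D3 n" using v bump_D3 pp by auto
    have le: "n - m \<le> bump a v k" if "n - m \<le> v k" for a k using that by (auto simp: bump_apply)
    have out: "\<not> n - m \<le> v k" if "k \<in> K" for k
      using v(2) g_in[OF D(1) that] g_in[OF D(2) that] le by metis
    have g1: "g (bump a v) = f (bump a v)" if "bump a v \<in> D3 n" for a
      using g_eq[OF that] out by (force simp: bump_apply split: if_splits)
    show ?thesis using v out g1[OF D(1)] g1[OF D(2)] by (auto simp: cut_edges_iff[OF p])
  qed
  \<comment> \<open>A fixed direction other than \<open>k\<close>: \<open>Z k\<close> collects the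
    cut edges of the triangle on which the \<open>d k\<close>-th coordinate is constant.\<close>
  define d where "d k = (SOME l. l \<in> face_ix \<and> l \<noteq> k)" for k
  have d: "d k \<in> face_ix \<and> d k \<noteq> k" if kf: "k \<in> face_ix" for k
  proof -
    obtain i j where "perm3 i j k" using perm3_extend kf .
    then have "\<exists>l. l \<in> face_ix \<and> l \<noteq> k" using perm3_mem perm3_neq by metis
    then show ?thesis unfolding d_def by (rule someI_ex)
  qed
  define Z where "Z k = {(v, l) \<in> cut_edges n f. l = d k \<and> n - m \<le> v k}" for k
  have finZ: "finite (Z k)" for k by (rule finite_subset[OF _ finite_cut_edges]) (auto simp: Z_def)
  have Z: "card {v \<in> D3 (n - 1). n - m \<le> v k \<and> mono_cell face_ix f v 5} \<le> n * card (Z k)"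
    if k: "k \<in> K" for k
  proof -
    have kf: "k \<in> face_ix" using k K by auto
    obtain e where p: "perm3 k e (d k)" using perm3_extend2 d[OF kf] kf by metis
    have p': "perm3 k (d k) e" using p by (auto simp: perm3_def)
    have "card {v \<in> D3 (n - 1). n - m \<le> v k \<and> mono_cell face_ix f v 5}
      \<le> card ((\<lambda>(v, l). v (d k)) ` Z k) * card {n - m..<n}"
    proof (rule card_cells_coord_le[OF p', of _ _ _ "n - 1" "\<lambda>x. x"])
      fix v assume "v \<in> {v \<in> D3 (n - 1). n - m \<le> v k \<and> mono_cell face_ix f v 5}"
      then have v: "v \<in> D3 (n - 1)" "n - m \<le> v k" "f (bump k v) = 5"
        using kf by (auto simp: mono_cell_def)
      have s: "v k + v e + v (d k) = n - 1" using v perm3_lat[OF p] by simp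
      let ?t = "v (d k)"
      have e1: "n - ?t - v e = Suc (v k)" "v e \<le> m - ?t" "m - ?t + ?t \<le> n" "n - ?t - (m - ?t) = n - m" "v k < n"
        using s v(2) n h m by linarith+
      have "bump k v = tri k e (d k) (Suc (v k)) (v e) ?t"
        using tri_bump(1)[OF p] tri_eta[OF p v(1)] by metis
      \<comment> \<open>The line through \<open>bump k v\<close> leads from this \<open>5\<close> to
        a point of the base labelled \<open>k\<close>, so it contains an edge of \<open>Z k\<close>.
        Hence the \<open>5\<close>-cells lie on at most \<open>card (Z k)\<close> lines of at most
        \<open>n\<close> cells each.\<close>
      then have "f (tri k e (d k) (n - ?t - v e) (v e) ?t) = 5" using v e1 by simp
      moreover have "tri k e (d k) (n - m) (m - ?t) ?t \<in> ring n m k"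
        using e1 s v(2) by (simp add: ring_def tri_lat[OF p] tri_at[OF p])
      then have "f (tri k e (d k) (n - ?t - (m - ?t)) (m - ?t) ?t) = k" using ring[OF k] e1 by simp
      moreover have "k \<noteq> 5" using kf face_ix(4) by metis
      ultimately obtain r where r: "r < m - ?t" "(tri k e (d k) (n - ?t - r - 1) r ?t, d k) \<in> cut_edges n f"
        using line_cut[OF p e1(2,3)] by metis
      have "n - m \<le> n - ?t - r - 1" using r(1) m by linarith
      then have "(tri k e (d k) (n - ?t - r - 1) r ?t, d k) \<in> Z k"
        using r by (simp add: Z_def tri_at[OF p])
      then have "?t \<in> (\<lambda>(v, l). v (d k)) ` Z k" by (rule rev_image_eqI) (simp add: tri_at[OF p])
      then show "v \<in> D3 (n - 1) \<and> v (d k) \<in> (\<lambda>(v, l). v (d k)) ` Z k \<and> v k \<in> {n - m..<n}"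
        using v e1 by simp
    qed (use finZ in auto)
    also have "\<dots> \<le> card (Z k) * n"
      by (rule mult_le_mono) (use card_image_le[OF finZ] in auto)
    finally show ?thesis by (simp add: mult.commute)
  qed
  have "(\<Sum>(v, k)\<in>cut_edges n g. wt h v k) + (\<Sum>k\<in>K. card (Z k)) \<le> (\<Sum>(v, k)\<in>cut_edges n f. wt h v k)"
  proof -
    have finK: "finite K" by (rule finite_subset[OF K]) simp
    have "(\<Sum>k\<in>K. card (Z k)) = card (\<Union>k\<in>K. Z k)"
    proof (rule card_UN_disjoint[symmetric])
      show "\<forall>k\<in>K. \<forall>l\<in>K. k \<noteq> l \<longrightarrow> Z k \<inter> Z l = {}"
      proof (intro ballI impI)
        fix k l assume kl: "k \<in> K" "l \<in> K" "k \<noteq> l"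
        have "e \<notin> Z l" if e: "e \<in> Z k" for e
        proof
          assume e': "e \<in> Z l"
          have "fst e \<in> D3 (n - 1)" "n - m \<le> fst e k" "n - m \<le> fst e l"
            using e e' by (auto simp: Z_def cut_edges_def)
          then show False using uniq[of "fst e" "n - 1" k l] kl K by auto
        qed
        then show "Z k \<inter> Z l = {}" by blast
      qed
    qed (use finK finZ in auto)
    also have "\<dots> \<le> (\<Sum>(v, k)\<in>(\<Union>k\<in>K. Z k). wt h v k)"
    proof -
      have "1 \<le> (case e of (v, l) \<Rightarrow> wt h v l)" if eZ: "e \<in> (\<Union>k\<in>K. Z k)" for e
      proof -
        obtain v l where e: "e = (v, l)" by (cases e)
        obtain k where k: "k \<in> K" "(v, l) \<in> Z k" using eZ unfolding e by blast
        then have kf: "k \<in> face_ix" using K by auto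
        have vl: "(v, l) \<in> cut_edges n f" "l = d k" "n - m \<le> v k" using k by (auto simp: Z_def)
        obtain j where p: "perm3 k j l" using perm3_extend2 d[OF kf] kf vl(2) by metis
        have "v k + v j + v l = n - 1" using vl(1) perm3_lat[OF p] by (auto simp: cut_edges_def)
        \<comment> \<open>\<open>v k\<close> exceeds \<open>n / 2\<close>, so \<open>v l\<close> is
          small and the lost edge does not have weight \<open>0\<close>.\<close>
        then have "v l \<le> 2 * h" using vl(3) m n by linarith
        then show ?thesis by (simp add: e wt_def)
      qed
      then show ?thesis unfolding card_eq_sum by (rule sum_mono)
    qed
    finally have "(\<Sum>(v, k)\<in>cut_edges n g. wt h v k) + (\<Sum>k\<in>K. card (Z k))
        \<le> (\<Sum>(v, k)\<in>cut_edges n g. wt h v k) + (\<Sum>(v, k)\<in>(\<Union>k\<in>K. Z k). wt h v k)" by simp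
    also have "\<dots> = (\<Sum>(v, k)\<in>cut_edges n g \<union> (\<Union>k\<in>K. Z k). wt h v k)"
    proof (rule sum.union_disjoint[symmetric])
      show "cut_edges n g \<inter> (\<Union>k\<in>K. Z k) = {}"
      proof -
        have "e \<notin> Z k" if "e \<in> cut_edges n g" "k \<in> K" for e k
        proof -
          obtain v l where "e = (v, l)" by (cases e)
          moreover have "d k \<noteq> k" using d that(2) K by blast
          ultimately show ?thesis using cut[of v l] that by (auto simp: Z_def)
        qed
        then show ?thesis by blast
      qed
    qed (use finK finZ in auto)
    also have "\<dots> \<le> (\<Sum>(v, k)\<in>cut_edges n f. wt h v k)"
    proof (rule sum_mono2)
      have "cut_edges n g \<subseteq> cut_edges n f" by (rule subrelI) (use cut in blast)
      then show "cut_edges n g \<union> (\<Union>k\<in>K. Z k) \<subseteq> cut_edges n f" unfolding Z_def by blast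
    qed auto
    finally show ?thesis .
  qed
  then have "2 * n + (\<Sum>k\<in>K. card (Z k)) \<le> (\<Sum>(v, k)\<in>cut_edges n f. wt h v k)"
    using g.weight_ge by linarith
  then have "n * (2 * n + (\<Sum>k\<in>K. card (Z k))) \<le> n * (\<Sum>(v, k)\<in>cut_edges n f. wt h v k)" by simp
  moreover have "(\<Sum>k\<in>K. card {v \<in> D3 (n - 1). n - m \<le> v k \<and> mono_cell face_ix f v 5})
      \<le> n * (\<Sum>k\<in>K. card (Z k))"
    unfolding sum_distrib_left by (rule sum_mono) (rule Z)
  ultimately show ?thesis by (simp add: algebra_simps)
qed

end

text \<open>Cells labelled \<open>5\<close> are charged in the direction \<open>4\<close>, so that
  the surplus cells have \<open>v 4 = 0\<close> and stand on the face. Such a cell is not all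
  \<open>5\<close> if its triangle in the face is not.\<close>

lemma card_nonmono_tetrahedra:
  fixes f :: "(nat \<Rightarrow> nat) \<Rightarrow> nat"
  assumes "2 \<le> n" and support: "\<And>x. x \<in> lat {1..4} n \<Longrightarrow> f x \<noteq> 5 \<Longrightarrow> 0 < x (f x)"
  shows "card {v \<in> D3 (n - 1). \<not> mono_cell face_ix f v 5}
    \<le> card {v \<in> lat {1..4} (n - 1). \<forall>a\<in>insert 5 {1..4}. \<not> mono_cell {1..4} f v a}"
proof -
  have n2: "Suc (n - 2) = n - 1" "Suc (n - 1) = n" using assms(1) by auto
  have sub: "face_ix \<subseteq> {1..4}" by (auto simp: face_ix_def)
  have D: "D3 d \<subseteq> {v \<in> lat {1..4} d. v 4 = 0}" for d
  proof
    fix v assume "v \<in> D3 d"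
    then have v: "\<And>i. i \<notin> face_ix \<Longrightarrow> v i = 0" "sum v face_ix = d" by (auto simp: lat_def)
    have "sum v {1..4} = sum v face_ix" using sub v(1) by (intro sum.mono_neutral_right) auto
    moreover have "\<forall>i. i \<notin> {1..4} \<longrightarrow> v i = 0" "v 4 = 0" using v(1) sub face_ix(3) by blast+
    ultimately show "v \<in> {v \<in> lat {1..4} d. v 4 = 0}" using v(2) by (simp add: lat_def)
  qed
  have "\<And>x. x \<in> lat {1..4} (Suc (Suc (n - 2))) \<Longrightarrow> f x \<in> {1..4} \<Longrightarrow> 0 < x (f x)"
    using support unfolding n2 by force
  then have "card {v \<in> lat {1..4} (n - 1). v 4 = 0 \<and> \<not> mono_cell {1..4} f v 5}
    \<le> card {v \<in> lat {1..4} (n - 1). \<forall>a\<in>insert 5 {1..4}. \<not> mono_cell {1..4} f v a}"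
    using card_nonmono_cells[of "{1..4}" 4 5 "n - 2" f] unfolding n2 by simp
  moreover have "{v \<in> D3 (n - 1). \<not> mono_cell face_ix f v 5}
      \<subseteq> {v \<in> lat {1..4} (n - 1). v 4 = 0 \<and> \<not> mono_cell {1..4} f v 5}"
    using D sub by (auto simp: mono_cell_def)
  then have "card {v \<in> D3 (n - 1). \<not> mono_cell face_ix f v 5}
      \<le> card {v \<in> lat {1..4} (n - 1). v 4 = 0 \<and> \<not> mono_cell {1..4} f v 5}"
    by (intro card_mono) auto
  ultimately show ?thesis by linarith
qed

text \<open>An edge is encoded by its cell and its two directions, ordered so that it is counted
  once.\<close>

definition cut_pairs :: "nat \<Rightarrow> ((nat \<Rightarrow> nat) \<Rightarrow> nat) \<Rightarrow> ((nat \<Rightarrow> nat) \<times> nat \<times> nat) set" where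
  "cut_pairs n f = {(v, i, j). v \<in> lat {1..4} (n - 1) \<and> i \<in> {1..4} \<and> j \<in> {1..4} \<and> i < j
     \<and> f (bump i v) \<noteq> f (bump j v)}"

lemma finite_cut_pairs [simp]: "finite (cut_pairs n f)"
  by (rule finite_subset[of _ "lat {1..4} (n - 1) \<times> {1..4} \<times> {1..4}"]) (auto simp: cut_pairs_def)

lemma card_cut_pairs:
  assumes range: "\<And>x. x \<in> lat {1..4} n \<Longrightarrow> f x \<in> {1..5}" and "0 < n"
  shows "3 * card {v \<in> lat {1..4} (n - 1). \<forall>a\<in>insert 5 {1..4}. \<not> mono_cell {1..4} f v a}
    \<le> card (cut_pairs n f)"
proof -
  let ?N = "{v \<in> lat {1..4} (n - 1). \<forall>a\<in>insert 5 {1..4}. \<not> mono_cell {1..4} f v a}"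
  let ?K = "\<lambda>v. {(i, j). (v, i, j) \<in> cut_pairs n f}"
  have fin: "finite (?K v)" for v
    by (rule finite_subset[of _ "{1..4} \<times> {1..4}"]) (auto simp: cut_pairs_def)
  have "3 \<le> card (?K v)" if v: "v \<in> ?N" for v
  proof -
    let ?q = "\<lambda>i. f (bump i v)"
    have "bump 1 v \<in> lat {1..4} n" using v \<open>0 < n\<close> bump_lat[of "{1..4}" 1 v "n - 1"] by simp
    then have "?q 1 \<in> insert 5 {1..4}" using range by force
    then have "\<not> mono_cell {1..4} f v (?q 1)" using v by blast
    then have ne: "\<not> (?q 1 = ?q 2 \<and> ?q 1 = ?q 3 \<and> ?q 1 = ?q 4)"
      unfolding mono_cell_def by (auto simp: atLeastAtMost_insertL[symmetric] numeral_eq_Suc)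
    have K: "(i, j) \<in> ?K v \<longleftrightarrow> ?q i \<noteq> ?q j" if "i \<in> {1..4}" "j \<in> {1..4}" "i < j" for i j
      using v that by (simp add: cut_pairs_def)
    have "\<exists>A \<subseteq> ?K v. card A = 3"
    proof -
      have k: "(1, 2) \<in> ?K v \<longleftrightarrow> ?q 1 \<noteq> ?q 2" "(1, 3) \<in> ?K v \<longleftrightarrow> ?q 1 \<noteq> ?q 3"
        "(1, 4) \<in> ?K v \<longleftrightarrow> ?q 1 \<noteq> ?q 4" "(2, 3) \<in> ?K v \<longleftrightarrow> ?q 2 \<noteq> ?q 3"
        "(2, 4) \<in> ?K v \<longleftrightarrow> ?q 2 \<noteq> ?q 4" "(3, 4) \<in> ?K v \<longleftrightarrow> ?q 3 \<noteq> ?q 4"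
        by (rule K; simp)+
      have c: "card {a, b, c} = 3" if "a \<noteq> b" "a \<noteq> c" "b \<noteq> c" for a b c :: "nat \<times> nat"
        using that by simp
      \<comment> \<open>The first four cases separate one corner from the other three; the last
        three list three of the four edges across a split into two pairs.\<close>
      consider "?q 1 \<noteq> ?q 2" "?q 1 \<noteq> ?q 3" "?q 1 \<noteq> ?q 4" | "?q 1 \<noteq> ?q 2" "?q 2 \<noteq> ?q 3" "?q 2 \<noteq> ?q 4"
        | "?q 1 \<noteq> ?q 3" "?q 2 \<noteq> ?q 3" "?q 3 \<noteq> ?q 4" | "?q 1 \<noteq> ?q 4" "?q 2 \<noteq> ?q 4" "?q 3 \<noteq> ?q 4"
        | "?q 1 \<noteq> ?q 3" "?q 1 \<noteq> ?q 4" "?q 2 \<noteq> ?q 3" | "?q 1 \<noteq> ?q 2" "?q 1 \<noteq> ?q 4" "?q 2 \<noteq> ?q 3"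
        | "?q 1 \<noteq> ?q 2" "?q 1 \<noteq> ?q 3" "?q 2 \<noteq> ?q 4"
        using ne by metis
      then show ?thesis
      proof cases
        case 1 then show ?thesis using k by (intro exI[of _ "{(1, 2), (1, 3), (1, 4)}"]) simp
      next
        case 2 then show ?thesis using k by (intro exI[of _ "{(1, 2), (2, 3), (2, 4)}"]) simp
      next
        case 3 then show ?thesis using k by (intro exI[of _ "{(1, 3), (2, 3), (3, 4)}"]) simp
      next
        case 4 then show ?thesis using k by (intro exI[of _ "{(1, 4), (2, 4), (3, 4)}"]) simp
      next
        case 5 then show ?thesis using k by (intro exI[of _ "{(1, 3), (1, 4), (2, 3)}"]) simp
      next
        case 6 then show ?thesis using k by (intro exI[of _ "{(1, 2), (1, 4), (2, 3)}"]) simp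
      next
        case 7 then show ?thesis using k by (intro exI[of _ "{(1, 2), (1, 3), (2, 4)}"]) simp
      qed
    qed
    then show ?thesis using card_mono[OF fin] by metis
  qed
  then have "3 * card ?N \<le> (\<Sum>v\<in>?N. card (?K v))"
    using sum_mono[of ?N "\<lambda>_. 3" "\<lambda>v. card (?K v)"] by (simp add: mult.commute)
  also have "\<dots> = card (SIGMA v : ?N. ?K v)" using fin by simp
  also have "\<dots> \<le> card (cut_pairs n f)" by (intro card_mono) auto
  finally show ?thesis .
qed

section \<open>Costs of the four instances\<close>

definition pt :: "nat \<Rightarrow> (nat \<Rightarrow> nat) \<Rightarrow> point" where
  "pt n x = (\<lambda>i. real (x i) / real n)"

definition edge :: "nat \<Rightarrow> (nat \<Rightarrow> nat) \<Rightarrow> nat set \<Rightarrow> point set" where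
  "edge n v A = (\<lambda>i. pt n (bump i v)) ` A"

definition is_cut_edge :: "(point \<Rightarrow> nat) \<Rightarrow> point set \<Rightarrow> bool" where
  "is_cut_edge P e \<longleftrightarrow> (\<exists>x y. e = {x, y} \<and> P x \<noteq> P y)"

lemma pt_inject: "0 < n \<Longrightarrow> pt n x = pt n y \<longleftrightarrow> x = y"
  by (auto simp: pt_def fun_eq_iff)

lemma face_ix_eq: "face_ix = {1..3}"
  by (auto simp: face_ix_def)

lemma D3_lat4: "D3 m = {x \<in> lat {1..4} m. x 4 = 0}"
proof -
  have "{1..4::nat} = insert 4 face_ix" by (auto simp: face_ix_def)
  then show ?thesis unfolding lat_def by (auto; metis)
qed

lemma pt_Delta:
  assumes "x \<in> lat {1..k} n" "0 < n"
  shows "pt n x \<in> Delta k n"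
proof -
  have "x i \<le> n" if "i \<in> {1..k}" for i
    using assms(1) member_le_sum[of i "{1..k}" x] that by (auto simp: lat_def)
  moreover have "(\<Sum>i=1..k. real (x i) / real n) = 1"
  proof -
    have "(\<Sum>i=1..k. real (x i)) = real n" using assms(1) by (simp add: lat_def flip: of_nat_sum)
    then show ?thesis using assms(2) by (simp flip: sum_divide_distrib)
  qed
  ultimately show ?thesis using assms unfolding Delta_def pt_def by (auto simp: lat_def)
qed

text \<open>The cell of an edge is the coordinatewise minimum of its two ends.\<close>

lemma bump_pair_inject:
  assumes "bump i v = bump i' v'" "bump j v = bump j' v'" "i \<noteq> j"
  shows "v = v' \<and> i = i' \<and> j = j'"
proof -
  have "i = i'"
  proof (rule ccontr)
    assume "i \<noteq> i'"
    then have "Suc (v i) = v' i" using fun_cong[OF assms(1), of i] by (simp add: bump_apply)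
    moreover have "v' i \<le> v i"
      using fun_cong[OF assms(2), of i] assms(3) by (simp add: bump_apply split: if_splits)
    ultimately show False by simp
  qed
  then have "v = v'" using assms(1) bump_inject by metis
  moreover have "j = j'"
  proof (rule ccontr)
    assume "j \<noteq> j'"
    then show False
      using fun_cong[OF assms(2), of j] \<open>v = v'\<close> by (simp add: bump_apply)
  qed
  ultimately show ?thesis using \<open>i = i'\<close> by simp
qed

lemma edge_inject:
  assumes "0 < n" "i \<noteq> j" "i' \<noteq> j'" "edge n v {i, j} = edge n v' {i', j'}"
  shows "v = v' \<and> {i, j} = {i', j'}"
proof -
  have "bump i v = bump i' v' \<and> bump j v = bump j' v' \<or> bump i v = bump j' v' \<and> bump j v = bump i' v'"
    using assms(4) by (simp add: edge_def doubleton_eq_iff pt_inject[OF assms(1)])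
  then show ?thesis using bump_pair_inject[OF _ _ assms(2)] by blast
qed

lemma edge_E:
  assumes "v \<in> lat {1..k} (n - 1)" "i \<in> {1..k}" "j \<in> {1..k}" "i \<noteq> j" "0 < n"
  shows "edge n v {i, j} \<in> E k n"
proof -
  have D: "pt n (bump l v) \<in> Delta k n" if "l \<in> {1..k}" for l
    using that assms bump_lat[of "{1..k}" l v "n - 1"] by (intro pt_Delta) simp_all
  have "\<bar>pt n (bump i v) l - pt n (bump j v) l\<bar> = (if l \<in> {i, j} then 1 / real n else 0)" for l
    using assms(4) by (auto simp: pt_def bump_apply simp flip: diff_divide_distrib)
  then have "(\<Sum>l=1..k. \<bar>pt n (bump i v) l - pt n (bump j v) l\<bar>)
      = (\<Sum>l\<in>{1..k} \<inter> {i, j}. 1 / real n)"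
    by (simp only: sum.inter_restrict finite_atLeastAtMost)
  also have "{1..k} \<inter> {i, j} = {i, j}" using assms by auto
  finally show ?thesis using D assms by (auto simp: E_def edge_def)
qed

lemma cost_ge:
  fixes a :: "'s \<Rightarrow> real"
  assumes "0 < n" "\<And>e. 0 \<le> w e" "inj_on g S" "\<And>s. s \<in> S \<Longrightarrow> g s \<in> E 4 n \<and> is_cut_edge P (g s)"
    and "\<And>s. s \<in> S \<Longrightarrow> a s \<le> w (g s)"
  shows "sum a S \<le> cost n w P"
proof -
  have "sum a S \<le> (\<Sum>s\<in>S. w (g s))" using assms(5) by (rule sum_mono)
  also have "\<dots> = sum w (g ` S)" using assms(3) by (simp add: sum.reindex)
  also have "\<dots> \<le> cost n w P"
    unfolding cost_def using assms finite_E[OF assms(1)]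
    by (intro sum_mono2) (auto simp: is_cut_edge_def)
  finally show ?thesis .
qed

lemma cost_combined: "cost n (combined_instance n c l1 l2 l3 l4) P =
    l1 * cost n (I1 n) P + l2 * cost n (I2 n) P + l3 * cost n (I3 n c) P + l4 * cost n (I4 n) P"
  by (simp add: cost_def combined_instance_def sum.distrib sum_distrib_left)

lemma J_ge_rho:
  assumes "\<exists>t. side_rank n e t" shows "rho n \<le> J n e"
proof -
  obtain t where t: "side_rank n e t" using assms by blast
  then have "t \<le> n div 3" unfolding side_rank_def by simp
  then have "real t \<le> real n / 3" by linarith
  then have "1 * rho n \<le> (real n / 3 - real t + 1) * rho n"
    by (intro mult_right_mono) (auto simp: rho_def)
  then show ?thesis using J_side_rank[OF t] by simp
qed

lemma J_nonneg: "0 \<le> J n e"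
proof (cases "\<exists>t. side_rank n e t")
  case True
  have "0 \<le> rho n" by (simp add: rho_def)
  then show ?thesis using J_ge_rho[OF True] by simp
qed (auto simp: J_def rho_def)

lemma L_face:
  assumes "perm3 i j k" "e \<in> L n i j" shows "e \<in> L n 1 2 \<union> L n 1 3 \<union> L n 2 3"
proof -
  have sym: "L n a b = L n b a" for a b by (auto simp: L_def V_def insert_commute)
  have "i \<in> {1, 2, 3} \<and> j \<in> {1, 2, 3} \<and> i \<noteq> j" using assms(1) by (auto simp: perm3_def face_ix_def)
  then show ?thesis using assms(2) sym by auto
qed

section \<open>The labelling induced by a cut, and its costs\<close>

locale nonopposite_cut =
  fixes n h :: nat and P :: "point \<Rightarrow> nat"
  assumes n: "n = 3 * h" and h: "0 < h" and cut: "is_cut n P" and nonopp: "non_opposite n P"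
begin

definition f :: "(nat \<Rightarrow> nat) \<Rightarrow> nat" where "f x = P (pt n x)"

lemma n_pos: "0 < n" using n h by simp

lemma f_range: "x \<in> lat {1..4} n \<Longrightarrow> f x \<in> {1..5}"
  using cut pt_Delta[OF _ n_pos] by (auto simp: is_cut_def f_def)

lemma f_support: "x \<in> lat {1..4} n \<Longrightarrow> f x \<noteq> 5 \<Longrightarrow> 0 < x (f x)"
  using nonopp pt_Delta[OF _ n_pos, of x 4] by (auto simp: non_opposite_def f_def Support_def pt_def)

sublocale face_labelling h n f
proof
  show "f x \<in> insert 5 face_ix" if "x \<in> D3 n" for x
  proof (cases "f x = 5")
    case False
    then have "0 < x (f x)" using that f_support D3_lat4 by auto
    then have "f x \<in> face_ix" using that by (auto simp: lat_def)
    then show ?thesis by simp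
  qed simp
  show "0 < x (f x)" if "x \<in> D3 n" "f x \<noteq> 5" for x using that f_support D3_lat4 by auto
  show "f (tri i j k n 0 0) = i" if p: "perm3 i j k" for i j k
  proof -
    have "pt n (tri i j k n 0 0) = unit_vec i"
      using n_pos by (auto simp: pt_def tri_def unit_vec_def fun_eq_iff)
    moreover have "i \<in> {1..4}" using perm3_mem(1)[OF p] by (auto simp: face_ix_def)
    ultimately show ?thesis using cut by (simp add: f_def is_cut_def)
  qed
qed (use n h in auto)

abbreviation face_edge :: "(nat \<Rightarrow> nat) \<times> nat \<Rightarrow> point set" where
  "face_edge \<equiv> \<lambda>(v, k). edge n v (face_ix - {k})"

lemma face_edge_eq: "perm3 i j k \<Longrightarrow> face_edge (v, k) = edge n v {i, j}"
proof -
  assume p: "perm3 i j k"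
  have "face_ix - {k} = {i, j}" using perm3_set[OF p] perm3_neq[OF p] by blast
  then show ?thesis by simp
qed

lemma face_edge_inj: "inj_on face_edge (cut_edges n f)"
proof (rule inj_onI)
  fix x y assume xy: "x \<in> cut_edges n f" "y \<in> cut_edges n f" "face_edge x = face_edge y"
  obtain v k w l where e: "x = (v, k)" "y = (w, l)" by (metis surj_pair)
  have kl: "k \<in> face_ix" "l \<in> face_ix" using xy e by (auto simp: cut_edges_def)
  obtain i j where p: "perm3 i j k" using perm3_extend kl(1) .
  obtain a b where q: "perm3 a b l" using perm3_extend kl(2) .
  have "v = w \<and> {i, j} = {a, b}"
    using edge_inject[OF n_pos perm3_neq(1)[OF p] perm3_neq(1)[OF q]] xy(3)
    unfolding e face_edge_eq[OF p] face_edge_eq[OF q] by blast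
  moreover have "k = l" if "{i, j} = {a, b}"
    using that perm3_set[OF p] perm3_set[OF q] perm3_neq[OF p] perm3_neq[OF q] by auto
  ultimately show "x = y" by (simp add: e)
qed

lemma face_edge_E:
  assumes "v \<in> D3 (n - 1)" "k \<in> face_ix"
  shows "face_edge (v, k) \<in> E 3 n" "face_edge (v, k) \<in> E 4 n"
proof -
  obtain i j where p: "perm3 i j k" using perm3_extend assms(2) .
  have "i \<in> {1..3}" "j \<in> {1..3}" using perm3_mem[OF p] face_ix_eq by auto
  moreover have "v \<in> lat {1..3} (n - 1)" "v \<in> lat {1..4} (n - 1)"
    using assms(1) D3_lat4[of "n - 1"] by (simp_all add: face_ix_eq)
  ultimately have "edge n v {i, j} \<in> E 3 n" "edge n v {i, j} \<in> E 4 n"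
    using perm3_neq(1)[OF p] n_pos by (auto intro!: edge_E)
  then show "face_edge (v, k) \<in> E 3 n" "face_edge (v, k) \<in> E 4 n"
    by (simp_all only: face_edge_eq[OF p])
qed

lemma face_edge_cut:
  assumes "s \<in> cut_edges n f"
  shows "face_edge s \<in> E 3 n \<and> face_edge s \<in> E 4 n \<and> is_cut_edge P (face_edge s)"
proof -
  obtain v k where s: "s = (v, k)" by (cases s)
  then have vk: "v \<in> D3 (n - 1)" "k \<in> face_ix" using assms by (auto simp: cut_edges_def)
  obtain i j where p: "perm3 i j k" using perm3_extend vk(2) .
  have "f (bump i v) \<noteq> f (bump j v)" using assms s cut_edges_iff[OF p] by simp
  then have "is_cut_edge P (face_edge s)"
    unfolding s face_edge_eq[OF p] is_cut_edge_def by (auto simp: edge_def f_def)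
  then show ?thesis using face_edge_E[OF vk] s by simp
qed

lemma face_edge_L:
  assumes p: "perm3 i j k" and v: "v \<in> D3 (n - 1)" "v k = 0"
  shows "face_edge (v, k) \<in> L n i j"
proof -
  have "bump l v \<in> lat {1..4} n" if "l \<in> {i, j}" for l
    using that bump_D3 v(1) perm3_mem[OF p] D3_lat4 by blast
  moreover have "Support (pt n (bump l v)) \<subseteq> {i, j}" if "l \<in> {i, j}" for l
    using v that perm3_lat[OF p] by (auto simp: Support_def pt_def bump_apply split: if_splits)
  ultimately show ?thesis
    using face_edge_E(2)[OF v(1) perm3_mem(3)[OF p]] pt_Delta[OF _ n_pos]
    unfolding L_def V_def face_edge_eq[OF p] by (auto simp: edge_def)
qed

text \<open>The rank is \<open>t = n - v i\<close>, and \<open>2 * h \<le> v i\<close> says that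
  \<open>t \<le> n / 3\<close>.\<close>

lemma side_rank_face_edge:
  assumes p: "perm3 i j k" and v: "v \<in> D3 (n - 1)" "v k = 0" "2 * h \<le> v i"
  shows "side_rank n (face_edge (v, k)) (n - v i)"
proof -
  have s: "v i + v j = n - 1" using v perm3_lat[OF p] by simp
  have t: "n - v i \<in> {1..n div 3}" using s v(3) n h by auto
  have r: "real (n - v i) = real n - real (v i)" using s by (intro of_nat_diff) linarith
  have ij: "i \<in> {1..3}" "j \<in> {1..3}" "i \<noteq> j" using perm3_mem[OF p] perm3_neq[OF p] face_ix_eq by auto
  have "face_edge (v, k) = {pt n (bump i v), pt n (bump j v)}"
    unfolding face_edge_eq[OF p] by (simp add: edge_def)
  moreover have "pt n (bump i v) i = 1 - (real (n - v i) - 1) / real n"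
    "pt n (bump j v) i = 1 - real (n - v i) / real n"
    using n_pos ij(3) unfolding r by (simp_all add: pt_def bump_apply field_simps)
  ultimately show ?thesis unfolding side_rank_def
    using t ij face_edge_L[OF p v(1,2)] by blast
qed

lemma J_face_edge:
  assumes v: "v \<in> D3 (n - 1)" and k: "k \<in> face_ix"
  shows "rho n * real (wt h v k) \<le> J n (face_edge (v, k))"
proof (cases "v k = 0")
  case True
  have one: "rho n \<le> J n (face_edge (v, k))"
  proof (cases "\<exists>t. side_rank n (face_edge (v, k)) t")
    case False
    obtain i j where p: "perm3 i j k" using perm3_extend k .
    then show ?thesis using False L_face[OF p face_edge_L[OF p v True]] unfolding J_def by auto
  qed (rule J_ge_rho)
  show ?thesis
  proof (cases "\<exists>i\<in>face_ix. i \<noteq> k \<and> 2 * h \<le> v i")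
    case True
    then obtain i where i: "i \<in> face_ix" "i \<noteq> k" "2 * h \<le> v i" by blast
    obtain j where p: "perm3 i j k" using perm3_extend2 k i by metis
    have s: "v i + v j = n - 1" using v \<open>v k = 0\<close> perm3_lat[OF p] by simp
    have "face_ix - {k} = {i, j}" using perm3_set[OF p] perm3_neq[OF p] by blast
    \<comment> \<open>With \<open>t = n - v i\<close> this is \<open>h - t + 1\<close>, the factor
      of \<open>rho n\<close> in \<open>J\<close>.\<close>
    then have "wt h v k = 1 + (v i - 2 * h)"
      using s i(3) \<open>v k = 0\<close> n perm3_neq[OF p] by (simp add: wt_def)
    moreover have "real (n - v i) = real n - real (v i)" using s by (intro of_nat_diff) linarith
    ultimately have "rho n * real (wt h v k) = (real n / 3 - real (n - v i) + 1) * rho n"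
      using i(3) n by (simp add: of_nat_diff algebra_simps)
    also have "\<dots> = J n (face_edge (v, k))"
      using J_side_rank[OF side_rank_face_edge[OF p v \<open>v k = 0\<close> i(3)]] by simp
    finally show ?thesis by simp
  next
    case False
    then have "(\<Sum>i\<in>face_ix - {k}. v i - 2 * h) = 0" by (intro sum.neutral) force
    then show ?thesis using one True by (simp add: wt_def)
  qed
next
  case False
  obtain i j where p: "perm3 i j k" using perm3_extend k .
  note pp = perm3_neq[OF p]
  show ?thesis
  proof (cases "v k \<le> 2 * h")
    case True
    have "rho n \<le> J n (face_edge (v, k))"
    proof (cases "\<exists>t. side_rank n (face_edge (v, k)) t")
      case no: False
      \<comment> \<open>Among the corner coordinates the two ends agree only in the
        \<open>k\<close>-th, and \<open>v k \<le> 2 * h\<close> keeps them out of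
        \<open>T n k\<close>; so the clause of cost \<open>0\<close> does not apply.\<close>
      have "\<not> (\<exists>i\<in>{1..3}. \<exists>x y. face_edge (v, k) = {x, y} \<and> x \<in> T n i \<and> y \<in> T n i \<and> x i = y i)"
      proof
        assume "\<exists>i\<in>{1..3}. \<exists>x y. face_edge (v, k) = {x, y} \<and> x \<in> T n i \<and> y \<in> T n i \<and> x i = y i"
        then obtain l x y where l: "l \<in> {1..3}" and e: "face_edge (v, k) = {x, y}"
          and xy: "x \<in> T n l" "y \<in> T n l" "x l = y l" by blast
        have "{x, y} = {pt n (bump i v), pt n (bump j v)}"
          using e unfolding face_edge_eq[OF p] by (simp add: edge_def)
        then have "x = pt n (bump i v) \<and> y = pt n (bump j v) \<or> x = pt n (bump j v) \<and> y = pt n (bump i v)"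
          by (simp add: doubleton_eq_iff)
        then have b: "bump i v l = bump j v l" and xl: "x l = real (bump i v l) / real n"
          using xy(3) n_pos by (auto simp: pt_def)
        have "l \<in> {i, j, k}" using l unfolding face_ix_eq[symmetric] perm3_set[OF p] .
        then have "l = k" using b pp by (auto simp: bump_apply)
        then have "2 / 3 < real (v k) / real n" using xl xy(1) pp by (simp add: T_def bump_apply)
        then show False using True n h by (simp add: field_simps)
      qed
      then show ?thesis using no unfolding J_def by auto
    qed (rule J_ge_rho)
    then show ?thesis using False True by (simp add: wt_def)
  next
    case big: False
    then show ?thesis using False J_nonneg by (simp add: wt_def)
  qed
qed

lemma cost_I1_ge: "rho n * real (\<Sum>(v, k)\<in>cut_edges n f. wt h v k) \<le> cost n (I1 n) P"
proof -
  have "(\<Sum>s\<in>cut_edges n f. rho n * real (case s of (v, k) \<Rightarrow> wt h v k)) \<le> cost n (I1 n) P"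
  proof (rule cost_ge[OF n_pos _ face_edge_inj])
    show "rho n * real (case s of (v, k) \<Rightarrow> wt h v k) \<le> I1 n (face_edge s)"
      if "s \<in> cut_edges n f" for s
      using that face_edge_cut[OF that] J_face_edge by (auto simp: I1_def cut_edges_def)
  qed (use face_edge_cut J_nonneg in \<open>auto simp: I1_def\<close>)
  then show ?thesis by (simp add: sum_distrib_left)
qed

lemma cost_I2_ge: "real (\<Sum>k\<in>face_ix. card {(v, l) \<in> cut_edges n f. l = k \<and> v k = 0}) / 3 \<le> cost n (I2 n) P"
proof -
  let ?A = "\<lambda>k. {(v, l) \<in> cut_edges n f. l = k \<and> v k = 0}"
  have fin: "finite (?A k)" for k by (rule finite_subset[OF _ finite_cut_edges]) auto
  have sub: "(\<Union>k\<in>face_ix. ?A k) \<subseteq> cut_edges n f" by auto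
  have "(\<Sum>s\<in>(\<Union>k\<in>face_ix. ?A k). 1 / 3) \<le> cost n (I2 n) P"
  proof (rule cost_ge[OF n_pos _ inj_on_subset[OF face_edge_inj sub]])
    fix s assume s: "s \<in> (\<Union>k\<in>face_ix. ?A k)"
    then obtain v k where vk: "s = (v, k)" "k \<in> face_ix" "v k = 0" "v \<in> D3 (n - 1)"
      by (auto simp: cut_edges_def)
    obtain i j where p: "perm3 i j k" using perm3_extend vk(2) .
    show "1 / 3 \<le> I2 n (face_edge s)"
      using L_face[OF p face_edge_L[OF p vk(4,3)]] vk(1) by (simp add: I2_def)
  qed (use face_edge_cut sub in \<open>auto simp: I2_def\<close>)
  moreover have "card (\<Union>k\<in>face_ix. ?A k) = (\<Sum>k\<in>face_ix. card (?A k))"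
    by (rule card_UN_disjoint) (use fin in auto)
  ultimately show ?thesis by simp
qed

lemma ring_edge_red:
  assumes m: "0 < m" "m \<le> n" "c = real m / real n" and k: "k \<in> face_ix"
    and s: "(v, l) \<in> cut_edges n f" "ring_edge n m k (v, l)"
  shows "face_edge (v, l) \<in> red_edges n c k"
proof -
  have v: "v \<in> D3 (n - 1)" "l \<in> face_ix" using s(1) by (auto simp: cut_edges_def)
  have c: "1 - c = real (n - m) / real n" using m n_pos by (simp add: of_nat_diff field_simps)
  have D: "pt n (bump i v) \<in> Delta 4 n" "pt n (bump i v) 4 = 0" if "i \<in> face_ix" for i
    using that v bump_D3 pt_Delta[OF _ n_pos, of "bump i v" 4] D3_lat4[of n] by (auto simp: pt_def)
  have "pt n (bump i v) \<in> R n c k" if i: "i \<in> face_ix - {l}" for i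
  proof (cases "l = k")
    case True
    then have "v k = n - m" using s(2) by (simp add: ring_edge_def)
    then have "pt n (bump i v) \<in> U n c k" using i D[of i] True c by (auto simp: U_def pt_def bump_apply)
    then show ?thesis by (simp add: R_def)
  next
    case False
    then have vl: "v l = 0" "n - m \<le> v k" using s(2) by (auto simp: ring_edge_def)
    obtain j where p: "perm3 k j l" using perm3_extend2 v(2) k False by metis
    have "Support (pt n (bump i v)) \<subseteq> {j, k}"
      using v(1) vl(1) i perm3_lat[OF p] perm3_set[OF p]
      by (auto simp: Support_def pt_def bump_apply split: if_splits)
    then have "pt n (bump i v) \<in> V n j k" using D i by (simp add: V_def)
    moreover have "j \<in> {1..3} - {k}" using perm3_mem[OF p] perm3_neq[OF p] face_ix_eq by auto
    moreover have "1 - c \<le> pt n (bump i v) k"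
      unfolding c pt_def using vl(2) by (intro divide_right_mono) (auto simp: bump_apply)
    ultimately show ?thesis by (auto simp: R_def)
  qed
  then show ?thesis using face_edge_E(2)[OF v] by (auto simp: red_edges_def edge_def)
qed

text \<open>Each ring with a wrong label has two red cut edges of weight \<open>1 / (9 * c)\<close>,
  and \<open>2 * m < n\<close> keeps the edges of different rings apart.\<close>

lemma cost_I3_ge:
  assumes m: "0 < m" "2 * m < n" "c = real m / real n" and N: "N \<subseteq> face_ix"
    and bad: "\<And>k. k \<in> N \<Longrightarrow> \<exists>x\<in>ring n m k. f x \<noteq> k"
  shows "real (card N) * (2 / (9 * c)) \<le> cost n (I3 n c) P"
proof -
  let ?A = "\<lambda>k. {e \<in> cut_edges n f. ring_edge n m k e}"
  have mn: "m \<le> n" using m by simp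
  have c: "0 < c" using m n_pos by simp
  have sub: "(\<Union>k\<in>N. ?A k) \<subseteq> cut_edges n f" by auto
  have "(\<Sum>s\<in>(\<Union>k\<in>N. ?A k). 1 / (9 * c)) \<le> cost n (I3 n c) P"
  proof (rule cost_ge[OF n_pos _ inj_on_subset[OF face_edge_inj sub]])
    fix s assume s: "s \<in> (\<Union>k\<in>N. ?A k)"
    then obtain v l k where vk: "s = (v, l)" "k \<in> N" "(v, l) \<in> cut_edges n f" "ring_edge n m k (v, l)"
      by (cases s) auto
    then have k: "k \<in> face_ix" using N by auto
    then have "k \<in> {1, 2, 3}" by (simp add: face_ix_def)
    then show "1 / (9 * c) \<le> I3 n c (face_edge s)"
      using ring_edge_red[OF m(1) mn m(3) k vk(3,4)] vk(1) by (auto simp: I3_def)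
  qed (use face_edge_cut sub c in \<open>auto simp: I3_def\<close>)
  moreover have "card (\<Union>k\<in>N. ?A k) = (\<Sum>k\<in>N. card (?A k))"
  proof (rule card_UN_disjoint)
    show "\<forall>k\<in>N. \<forall>l\<in>N. k \<noteq> l \<longrightarrow> ?A k \<inter> ?A l = {}"
    proof (intro ballI impI)
      fix k l assume kl: "k \<in> N" "l \<in> N" "k \<noteq> l"
      then have kl': "k \<in> face_ix" "l \<in> face_ix" using N by auto
      then obtain j where p: "perm3 k j l" using perm3_extend2 kl(3) by metis
      have "\<not> (n - m \<le> v k \<and> n - m \<le> v l)" if "v \<in> D3 (n - 1)" for v
        using that perm3_lat[OF p, of v "n - 1"] m(2) by auto
      then show "?A k \<inter> ?A l = {}" by (auto simp: ring_edge_def cut_edges_def)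
    qed
  qed (use N finite_subset[OF N] in auto)
  moreover have "(\<Sum>k\<in>N. 2) \<le> (\<Sum>k\<in>N. card (?A k))"
    using bad N mn by (intro sum_mono) (use ring_two_cuts in blast)
  then have "real (2 * card N) \<le> real (\<Sum>k\<in>N. card (?A k))" by (simp only: of_nat_le_iff) (simp add: mult.commute)
  then have "real (2 * card N) * (1 / (9 * c)) \<le> real (\<Sum>k\<in>N. card (?A k)) * (1 / (9 * c))"
    using c by (intro mult_right_mono) auto
  ultimately show ?thesis by simp
qed

lemma cost_I4_ge:
  "3 * real (card {v \<in> D3 (n - 1). \<not> mono_cell face_ix f v 5}) / (real n)\<^sup>2 \<le> cost n (I4 n) P"
proof -
  let ?g = "\<lambda>(v, i, j). edge n v {i, j}"
  have "(\<Sum>s\<in>cut_pairs n f. 1 / (real n)\<^sup>2) \<le> cost n (I4 n) P"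
  proof (rule cost_ge[OF n_pos, of _ ?g])
    show "inj_on ?g (cut_pairs n f)"
    proof (rule inj_onI)
      fix x y assume xy: "x \<in> cut_pairs n f" "y \<in> cut_pairs n f" "?g x = ?g y"
      obtain v i j w a b where e: "x = (v, i, j)" "y = (w, a, b)" by (metis surj_pair)
      have l: "i < j" "a < b" using xy e by (auto simp: cut_pairs_def)
      then have "v = w \<and> {i, j} = {a, b}" using edge_inject[OF n_pos, of i j a b v w] xy(3) e by simp
      then show "x = y" using l e by (auto simp: doubleton_eq_iff)
    qed
    show "?g s \<in> E 4 n \<and> is_cut_edge P (?g s)" if "s \<in> cut_pairs n f" for s
    proof -
      obtain v i j where s: "s = (v, i, j)" by (metis surj_pair)
      then have "f (bump i v) \<noteq> f (bump j v)" "v \<in> lat {1..4} (n - 1)" "i \<in> {1..4}" "j \<in> {1..4}" "i \<noteq> j"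
        using that by (auto simp: cut_pairs_def)
      then show ?thesis using edge_E[of v 4 n i j] n_pos
        unfolding s is_cut_edge_def by (auto simp: edge_def f_def)
    qed
  qed (auto simp: I4_def)
  then have "real (card (cut_pairs n f)) / (real n)\<^sup>2 \<le> cost n (I4 n) P" by simp
  moreover have "3 * card {v \<in> D3 (n - 1). \<not> mono_cell face_ix f v 5} \<le> card (cut_pairs n f)"
    using card_cut_pairs[OF f_range n_pos] card_nonmono_tetrahedra[of n f] f_support n h by force
  then have "3 * real (card {v \<in> D3 (n - 1). \<not> mono_cell face_ix f v 5}) \<le> real (card (cut_pairs n f))"
    by linarith
  then have "3 * real (card {v \<in> D3 (n - 1). \<not> mono_cell face_ix f v 5}) / (real n)\<^sup>2
      \<le> real (card (cut_pairs n f)) / (real n)\<^sup>2" by (rule divide_right_mono) simp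
  ultimately show ?thesis by linarith
qed

end

section \<open>Trading cells labelled 5 between the instances\<close>

lemma INF_affine_le:
  fixes b l1 l4 a :: real
  assumes "0 \<le> l1" "0 \<le> l4" "a \<in> {0..b}"
  shows "(INF \<alpha>\<in>{0..b}. 0.4 * \<alpha> * l1 + 3 * (b - \<alpha>) * l4) \<le> 0.4 * a * l1 + 3 * (b - a) * l4"
proof (rule cINF_lower[OF _ assms(3)])
  show "bdd_below ((\<lambda>\<alpha>. 0.4 * \<alpha> * l1 + 3 * (b - \<alpha>) * l4) ` {0..b})"
    using assms by (intro bdd_belowI[of _ 0]) auto
qed

lemma cost_nonneg: "(\<And>e. 0 \<le> w e) \<Longrightarrow> 0 \<le> cost n w P"
  unfolding cost_def by (rule sum_nonneg)

context nonopposite_cut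
begin

text \<open>For \<open>m = n\<close> the condition on \<open>v k\<close> is void and all
  \<open>5\<close>-cells of the face are counted.\<close>

definition mono5_cells :: "nat \<Rightarrow> nat \<Rightarrow> (nat \<Rightarrow> nat) set" where
  "mono5_cells m k = {v \<in> D3 (n - 1). n - m \<le> v k \<and> mono_cell face_ix f v 5}"

lemma card_not_mono5:
  assumes "k \<in> face_ix" "m \<le> n"
  shows "(real m)\<^sup>2 / 2 - real (card (mono5_cells m k))
    \<le> real (card {v \<in> D3 (n - 1). n - m \<le> v k \<and> \<not> mono_cell face_ix f v 5})"
proof -
  have "card {v \<in> D3 (n - 1). n - m \<le> v k} = card (mono5_cells m k \<union>
      {v \<in> D3 (n - 1). n - m \<le> v k \<and> \<not> mono_cell face_ix f v 5})"
    by (rule arg_cong[where f = card]) (auto simp: mono5_cells_def)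
  also have "\<dots> \<le> card (mono5_cells m k)
      + card {v \<in> D3 (n - 1). n - m \<le> v k \<and> \<not> mono_cell face_ix f v 5}" by (rule card_Un_le)
  finally have "m * m \<le> 2 * (card (mono5_cells m k)
      + card {v \<in> D3 (n - 1). n - m \<le> v k \<and> \<not> mono_cell face_ix f v 5})"
    by (rule order_trans[OF card_corner_cells[OF assms] mult_le_mono2])
  then have "real (m * m) \<le> real (2 * (card (mono5_cells m k)
      + card {v \<in> D3 (n - 1). n - m \<le> v k \<and> \<not> mono_cell face_ix f v 5}))"
    unfolding of_nat_le_iff .
  then show ?thesis by (simp add: power2_eq_square)
qed

text \<open>The integer inequality is multiplied by
  \<open>rho n / n = 3 / (5 * n^2)\<close>.\<close>

lemma cost_I1_sq:
  assumes "2 * n * n + M \<le> n * (\<Sum>(v, k)\<in>cut_edges n f. wt h v k)"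
  shows "6 / 5 + 3 / 5 * (real M / (real n)\<^sup>2) \<le> cost n (I1 n) P"
proof -
  let ?W = "\<Sum>(v, k)\<in>cut_edges n f. wt h v k"
  have "real (2 * n * n + M) \<le> real (n * ?W)" using assms unfolding of_nat_le_iff .
  then have "3 / (5 * (real n)\<^sup>2) * real (2 * n * n + M) \<le> 3 / (5 * (real n)\<^sup>2) * real (n * ?W)"
    by (rule mult_left_mono) simp
  also have "3 / (5 * (real n)\<^sup>2) * real (n * ?W) = rho n * real ?W"
    using n_pos by (simp add: rho_def power2_eq_square)
  also have "\<dots> \<le> cost n (I1 n) P" by (rule cost_I1_ge)
  finally show ?thesis using n_pos by (simp add: power2_eq_square field_simps)
qed

text \<open>\<alpha> is the number of \<open>5\<close>-cells over \<open>n^2\<close>, capped: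
  \<open>weight_ge_no5\<close> makes \<open>I1\<close> pay for these cells, and \<open>I4\<close>
  pays for the remaining ones.\<close>

lemma costs_no5:
  assumes k: "k \<in> face_ix" and no5: "\<And>x. x \<in> D3 n \<Longrightarrow> x k = 0 \<Longrightarrow> f x \<noteq> 5"
  shows "\<exists>\<alpha>\<in>{0..1/2}. 6 / 5 + 2 / 5 * \<alpha> \<le> cost n (I1 n) P \<and> 3 * (1 / 2 - \<alpha>) \<le> cost n (I4 n) P"
proof -
  let ?W = "\<Sum>(v, k)\<in>cut_edges n f. wt h v k"
  let ?M = "card (mono5_cells n k)"
  \<comment> \<open>The face has \<open>n * (n + 1) / 2\<close> cells, slightly more than
    \<open>n^2 / 2\<close>; hence the cap.\<close>
  define \<alpha> where "\<alpha> = min (real ?M / (real n)\<^sup>2) (1 / 2)"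
  have "0 \<le> \<alpha>" "\<alpha> \<le> 1 / 2" unfolding \<alpha>_def by (simp, rule min.cobounded2)
  then have "\<alpha> \<in> {0..1/2}" by simp
  moreover have "6 / 5 + 2 / 5 * \<alpha> \<le> cost n (I1 n) P"
  proof (cases "2 * n + 2 * h \<le> ?W")
    case True
    have "n * (2 * n + 2 * h) \<le> n * ?W" using True by (rule mult_le_mono2)
    moreover have "n * (2 * n + 2 * h) = 2 * n * n + 6 * h * h" using n by (simp add: algebra_simps)
    ultimately have "2 * n * n + 6 * h * h \<le> n * ?W" by (simp only:)
    then have "6 / 5 + 3 / 5 * (real (6 * h * h) / (real n)\<^sup>2) \<le> cost n (I1 n) P" by (rule cost_I1_sq)
    moreover have "real (6 * h * h) / (real n)\<^sup>2 = 2 / 3" using n h by (simp add: power2_eq_square)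
    ultimately show ?thesis using \<open>\<alpha> \<le> 1 / 2\<close> by linarith
  next
    case False
    then have "2 * n * n + ?M \<le> n * ?W"
      using weight_ge_no5[OF k no5] by (simp add: mono5_cells_def)
    then have "6 / 5 + 3 / 5 * (real ?M / (real n)\<^sup>2) \<le> cost n (I1 n) P" by (rule cost_I1_sq)
    moreover have "0 \<le> real ?M / (real n)\<^sup>2" by simp
    ultimately show ?thesis unfolding \<alpha>_def by linarith
  qed
  moreover have "3 * (1 / 2 - \<alpha>) \<le> cost n (I4 n) P"
  proof -
    have "(real n)\<^sup>2 / 2 - real ?M \<le> real (card {v \<in> D3 (n - 1). \<not> mono_cell face_ix f v 5})"
      using card_not_mono5[OF k, of n] by simp
    then have "((real n)\<^sup>2 / 2 - real ?M) / (real n)\<^sup>2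
        \<le> real (card {v \<in> D3 (n - 1). \<not> mono_cell face_ix f v 5}) / (real n)\<^sup>2"
      by (rule divide_right_mono) simp
    then have "3 * (1 / 2 - real ?M / (real n)\<^sup>2) \<le> cost n (I4 n) P"
      using cost_I4_ge n_pos by (simp add: diff_divide_distrib)
    moreover have "0 \<le> cost n (I4 n) P" by (rule cost_nonneg) (simp add: I4_def)
    ultimately show ?thesis by (auto simp: \<alpha>_def min_def)
  qed
  ultimately show ?thesis by blast
qed

lemma cost_I2_ge_const:
  assumes "\<And>k. k \<in> face_ix \<Longrightarrow> d \<le> card {(v, l) \<in> cut_edges n f. l = k \<and> v k = 0}"
  shows "real d \<le> cost n (I2 n) P"
proof -
  let ?S = "\<Sum>k\<in>face_ix. card {(v, l) \<in> cut_edges n f. l = k \<and> v k = 0}"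
  have "(\<Sum>k\<in>face_ix. d) \<le> ?S" by (intro sum_mono assms)
  then have "real (3 * d) \<le> real ?S" unfolding of_nat_le_iff by simp
  then have "real (3 * d) / 3 \<le> real ?S / 3" by (rule divide_right_mono) simp
  also have "\<dots> \<le> cost n (I2 n) P" by (rule cost_I2_ge)
  finally show ?thesis by simp
qed

text \<open>\<open>K\<close> collects the corners whose ring is labelled correctly. They pay through
  \<open>I1\<close> and \<open>I4\<close>, each with its own share \<open>\<alpha> k\<close> of
  \<open>5\<close>-cells; the other corners pay through \<open>I3\<close>.\<close>

lemma costs_rings:
  assumes m: "0 < m" "2 * m < n" and c: "c = real m / real n"
  shows "\<exists>K\<subseteq>face_ix. \<exists>\<alpha>. (\<forall>k. \<alpha> k \<in> {0..c\<^sup>2 / 2})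
    \<and> 6 / 5 + (\<Sum>k\<in>K. 2 / 5 * \<alpha> k) \<le> cost n (I1 n) P
    \<and> real (card (face_ix - K)) * (2 / (9 * c)) \<le> cost n (I3 n c) P
    \<and> (\<Sum>k\<in>K. 3 * (c\<^sup>2 / 2 - \<alpha> k)) \<le> cost n (I4 n) P"
proof -
  define K where "K = {k \<in> face_ix. \<forall>x\<in>ring n m k. f x = k}"
  define \<alpha> where "\<alpha> k = min (real (card (mono5_cells m k)) / (real n)\<^sup>2) (c\<^sup>2 / 2)" for k
  let ?B = "\<lambda>k. {v \<in> D3 (n - 1). n - m \<le> v k \<and> \<not> mono_cell face_ix f v 5}"
  have K: "K \<subseteq> face_ix" "finite K" by (auto simp: K_def)
  have "0 \<le> \<alpha> k" "\<alpha> k \<le> c\<^sup>2 / 2" for k unfolding \<alpha>_def by (simp, rule min.cobounded2)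
  then have "\<forall>k. \<alpha> k \<in> {0..c\<^sup>2 / 2}" by simp
  moreover have "6 / 5 + (\<Sum>k\<in>K. 2 / 5 * \<alpha> k) \<le> cost n (I1 n) P"
  proof -
    have "2 * n * n + (\<Sum>k\<in>K. card (mono5_cells m k)) \<le> n * (\<Sum>(v, k)\<in>cut_edges n f. wt h v k)"
      unfolding mono5_cells_def by (rule weight_ge_rings[OF K(1) m(2)]) (simp add: K_def)
    then have "6 / 5 + 3 / 5 * (real (\<Sum>k\<in>K. card (mono5_cells m k)) / (real n)\<^sup>2) \<le> cost n (I1 n) P"
      by (rule cost_I1_sq)
    moreover have "(\<Sum>k\<in>K. 2 / 5 * \<alpha> k) \<le> (\<Sum>k\<in>K. 3 / 5 * (real (card (mono5_cells m k)) / (real n)\<^sup>2))"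
    proof (rule sum_mono)
      fix k
      have "0 \<le> real (card (mono5_cells m k)) / (real n)\<^sup>2" by simp
      then show "2 / 5 * \<alpha> k \<le> 3 / 5 * (real (card (mono5_cells m k)) / (real n)\<^sup>2)"
        unfolding \<alpha>_def by linarith
    qed
    ultimately show ?thesis by (simp add: sum_distrib_left sum_divide_distrib)
  qed
  moreover have "real (card (face_ix - K)) * (2 / (9 * c)) \<le> cost n (I3 n c) P"
    by (rule cost_I3_ge[OF m c]) (auto simp: K_def)
  moreover have "(\<Sum>k\<in>K. 3 * (c\<^sup>2 / 2 - \<alpha> k)) \<le> cost n (I4 n) P"
  proof -
    have "(\<Sum>k\<in>K. 3 * (c\<^sup>2 / 2 - \<alpha> k)) \<le> (\<Sum>k\<in>K. 3 * (real (card (?B k)) / (real n)\<^sup>2))"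
    proof (rule sum_mono)
      fix k assume "k \<in> K"
      then have "(real m)\<^sup>2 / 2 - real (card (mono5_cells m k)) \<le> real (card (?B k))"
        using card_not_mono5[of k m] K m by auto
      then have "((real m)\<^sup>2 / 2 - real (card (mono5_cells m k))) / (real n)\<^sup>2 \<le> real (card (?B k)) / (real n)\<^sup>2"
        by (rule divide_right_mono) simp
      then have "c\<^sup>2 / 2 - real (card (mono5_cells m k)) / (real n)\<^sup>2 \<le> real (card (?B k)) / (real n)\<^sup>2"
        unfolding c by (simp add: diff_divide_distrib power_divide mult.commute)
      moreover have "0 \<le> real (card (?B k)) / (real n)\<^sup>2" by simp
      ultimately show "3 * (c\<^sup>2 / 2 - \<alpha> k) \<le> 3 * (real (card (?B k)) / (real n)\<^sup>2)"
        unfolding \<alpha>_def min_def by (auto split: if_splits)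
    qed
    also have "\<dots> = 3 * real (\<Sum>k\<in>K. card (?B k)) / (real n)\<^sup>2"
      by (simp add: sum_distrib_left sum_divide_distrib)
    also have "(\<Sum>k\<in>K. card (?B k)) = card (\<Union>k\<in>K. ?B k)"
    proof (rule card_UN_disjoint[symmetric])
      show "\<forall>k\<in>K. \<forall>l\<in>K. k \<noteq> l \<longrightarrow> ?B k \<inter> ?B l = {}"
      proof (intro ballI impI)
        fix k l assume kl: "k \<in> K" "l \<in> K" "k \<noteq> l"
        then have kl': "k \<in> face_ix" "l \<in> face_ix" using K by auto
        then obtain j where p: "perm3 k j l" using perm3_extend2 kl(3) by metis
        have "\<not> (n - m \<le> v k \<and> n - m \<le> v l)" if "v \<in> D3 (n - 1)" for v
          using that perm3_lat[OF p, of v "n - 1"] m(2) by auto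
        then show "?B k \<inter> ?B l = {}" by auto
      qed
    qed (use K in auto)
    also have "3 * real (card (\<Union>k\<in>K. ?B k)) / (real n)\<^sup>2
        \<le> 3 * real (card {v \<in> D3 (n - 1). \<not> mono_cell face_ix f v 5}) / (real n)\<^sup>2"
      by (intro divide_right_mono mult_left_mono of_nat_mono card_mono) auto
    also have "\<dots> \<le> cost n (I4 n) P" by (rule cost_I4_ge)
    finally show ?thesis .
  qed
  ultimately show ?thesis using K(1) by blast
qed

end

theorem theorem3:
  fixes n :: nat and c l1 l2 l3 l4 :: real and P :: "point \<Rightarrow> nat"
  assumes "n \<ge> 10" and "3 dvd n"
    and "0 < c" and "c < 1 / 2" and "c * real n \<in> \<int>"
    and "l1 \<ge> 0" and "l2 \<ge> 0" and "l3 \<ge> 0" and "l4 \<ge> 0" and "l1 + l2 + l3 + l4 = 1"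
    and "is_cut n P" and "non_opposite n P"
  shows "cost n (combined_instance n c l1 l2 l3 l4) P \<ge>
    min
      (l2 + (1.2 - 1 / real n) * l1
        + (INF \<alpha>\<in>{0..1/2}. 0.4 * \<alpha> * l1 + 3 * (1/2 - \<alpha>) * l4))
      (2 * l2 + (1.2 - 5 / (2 * real n)) * l1
        + 3 * min (2 * l3 / (9 * c))
            (INF \<alpha>\<in>{0..c\<^sup>2/2}. 0.4 * \<alpha> * l1 + 3 * (c\<^sup>2/2 - \<alpha>) * l4))"
proof -
  obtain h where nh: "n = 3 * h" using assms(2) by (auto elim: dvdE)
  interpret nonopposite_cut n h P by unfold_locales (use assms nh in auto)
  let ?C = "cost n (combined_instance n c l1 l2 l3 l4) P"
  have n0: "0 < real n" using assms(1) by simp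
  have c3: "0 \<le> cost n (I3 n c) P" by (rule cost_nonneg) (use assms(3) in \<open>simp add: I3_def\<close>)
  note C = cost_combined[of n c l1 l2 l3 l4 P]
  show ?thesis
  proof (cases "\<forall>k\<in>face_ix. \<exists>x\<in>D3 n. x k = 0 \<and> f x = 5")
    \<comment> \<open>Some side has no \<open>5\<close>. Every side is still cut at least once, and
      \<open>costs_no5\<close> leads to the first term.\<close>
    case False
    then obtain k where "k \<in> face_ix" "\<And>x. x \<in> D3 n \<Longrightarrow> x k = 0 \<Longrightarrow> f x \<noteq> 5" by blast
    then obtain a where a: "a \<in> {0..1/2}" "6 / 5 + 2 / 5 * a \<le> cost n (I1 n) P"
      "3 * (1 / 2 - a) \<le> cost n (I4 n) P" using costs_no5 by metis
    have "1 \<le> cost n (I2 n) P" using cost_I2_ge_const[of 1] side_cut by simp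
    then have "l1 * (6 / 5 + 2 / 5 * a) + l2 * 1 + l3 * 0 + l4 * (3 * (1 / 2 - a)) \<le> ?C"
      unfolding C using a c3 assms by (intro add_mono mult_left_mono) auto
    moreover have "(INF \<alpha>\<in>{0..1/2}. 0.4 * \<alpha> * l1 + 3 * (1/2 - \<alpha>) * l4)
        \<le> 0.4 * a * l1 + 3 * (1/2 - a) * l4"
      using INF_affine_le assms a by blast
    moreover have "(1.2 - 1 / real n) * l1 \<le> 6 / 5 * l1"
      using assms n0 by (intro mult_right_mono) auto
    ultimately show ?thesis by (simp add: min_le_iff_disj algebra_simps)
  next
    \<comment> \<open>Every side contains a \<open>5\<close> and is cut at least twice;
      \<open>costs_rings\<close> leads to the second term.\<close>
    case True
    obtain m where m: "c * real n = real m"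
    proof -
      obtain z where z: "c * real n = of_int z" using assms(5) by (rule Ints_cases)
      have "0 < c * real n" using assms(3) n0 by simp
      then have "c * real n = real (nat z)" using z by simp
      then show thesis using that by blast
    qed
    have cm: "c = real m / real n" using m n0 by (simp add: field_simps)
    have m0: "0 < m" using m assms(3) n0 by (metis mult_pos_pos of_nat_0_less_iff)
    have "c * real n < 1 / 2 * real n" using assms(4) n0 by (rule mult_strict_right_mono)
    then have m2: "2 * m < n" using m by linarith
    obtain K \<alpha> where K: "K \<subseteq> face_ix" and a: "\<And>k. \<alpha> k \<in> {0..c\<^sup>2 / 2}"
      and c1: "6 / 5 + (\<Sum>k\<in>K. 2 / 5 * \<alpha> k) \<le> cost n (I1 n) P"
      and c3: "real (card (face_ix - K)) * (2 / (9 * c)) \<le> cost n (I3 n c) P"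
      and c4: "(\<Sum>k\<in>K. 3 * (c\<^sup>2 / 2 - \<alpha> k)) \<le> cost n (I4 n) P"
      using costs_rings[OF m0 m2 cm] by metis
    let ?I = "INF \<alpha>\<in>{0..c\<^sup>2/2}. 0.4 * \<alpha> * l1 + 3 * (c\<^sup>2/2 - \<alpha>) * l4"
    let ?m = "min (2 * l3 / (9 * c)) ?I"
    have "2 \<le> cost n (I2 n) P" 
    proof -
      have "2 \<le> card {(v, l) \<in> cut_edges n f. l = k \<and> v k = 0}" if k: "k \<in> face_ix" for k
      proof -
        obtain x where "x \<in> D3 n" "x k = 0" "f x = 5" using True k by blast
        then show ?thesis by (rule side_two_cuts[OF k])
      qed
      then show ?thesis using cost_I2_ge_const[of 2] by simp
    qed
    then have "l1 * (6 / 5 + (\<Sum>k\<in>K. 2 / 5 * \<alpha> k)) + l2 * 2 + l3 * (real (card (face_ix - K)) * (2 / (9 * c)))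
        + l4 * (\<Sum>k\<in>K. 3 * (c\<^sup>2 / 2 - \<alpha> k)) \<le> ?C"
      unfolding C using c1 c3 c4 assms by (intro add_mono mult_left_mono) auto
    \<comment> \<open>Each of the three corners contributes at least \<open>?m\<close>: one in
      \<open>K\<close> by the infimum compared at its \<open>\<alpha> k\<close>, one outside
      \<open>K\<close> by its red edges.\<close>
    moreover have "3 * ?m \<le> l1 * (\<Sum>k\<in>K. 2 / 5 * \<alpha> k) + l4 * (\<Sum>k\<in>K. 3 * (c\<^sup>2 / 2 - \<alpha> k))
        + l3 * (real (card (face_ix - K)) * (2 / (9 * c)))"
    proof -
      have fK: "finite K" by (rule finite_subset[OF K]) simp
      have "card K + card (face_ix - K) = 3"
        using card_Un_disjoint[of K "face_ix - K"] K fK by (simp add: Un_absorb1)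
      then have "real (card K) + real (card (face_ix - K)) = 3" by linarith
      then have "3 * ?m = real (card K) * ?m + real (card (face_ix - K)) * ?m"
        by (simp only: distrib_right[symmetric])
      also have "\<dots> \<le> (\<Sum>k\<in>K. l1 * (2 / 5 * \<alpha> k) + l4 * (3 * (c\<^sup>2 / 2 - \<alpha> k)))
          + real (card (face_ix - K)) * (2 * l3 / (9 * c))"
      proof (rule add_mono)
        show "real (card K) * ?m \<le> (\<Sum>k\<in>K. l1 * (2 / 5 * \<alpha> k) + l4 * (3 * (c\<^sup>2 / 2 - \<alpha> k)))"
        proof (rule sum_bounded_below)
          fix k
          have "?m \<le> ?I" by (rule min.cobounded2)
          also have "?I \<le> 0.4 * \<alpha> k * l1 + 3 * (c\<^sup>2/2 - \<alpha> k) * l4"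
            by (rule INF_affine_le[OF assms(6,9) a])
          also have "\<dots> = l1 * (2 / 5 * \<alpha> k) + l4 * (3 * (c\<^sup>2 / 2 - \<alpha> k))" by (simp add: algebra_simps)
          finally show "?m \<le> l1 * (2 / 5 * \<alpha> k) + l4 * (3 * (c\<^sup>2 / 2 - \<alpha> k))" .
        qed
        show "real (card (face_ix - K)) * ?m \<le> real (card (face_ix - K)) * (2 * l3 / (9 * c))"
          by (rule mult_left_mono[OF min.cobounded1]) simp
      qed
      also have "\<dots> = l1 * (\<Sum>k\<in>K. 2 / 5 * \<alpha> k) + l4 * (\<Sum>k\<in>K. 3 * (c\<^sup>2 / 2 - \<alpha> k))
        + l3 * (real (card (face_ix - K)) * (2 / (9 * c)))"
        unfolding sum.distrib sum_distrib_left[symmetric] by simp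
      finally show ?thesis .
    qed
    moreover have "(1.2 - 5 / (2 * real n)) * l1 \<le> 6 / 5 * l1"
      using assms n0 by (intro mult_right_mono) auto
    ultimately have "2 * l2 + (1.2 - 5 / (2 * real n)) * l1 + 3 * ?m \<le> ?C"
      by (simp only: distrib_left)
    then show ?thesis by (simp only: min_le_iff_disj) simp
  qed
qed

end
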